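(* Let $G$ be a finite group. Then $$G\backslash \sigma^G = m(G),$$ where $m(G)=\sum_{g\in G}\frac{1}{o(g)}$ is the sum of the inverses of the element orders in $G$, $\sigma^G=\sum_{H\in[s_G]}|G:H|\,e^G_H\in\mathbb{Q}B(G)$, and $G\backslash\alpha=\left|\mathrm{Def}^G_{G/G}(\alpha)\right|\in\mathbb{Q}$ for $\alpha\in\mathbb{Q}B(G)$.
   Context: Let $G$ be a finite group. $B(G)$ is the Burnside ring of $G$ (the Grothendieck ring of finite $G$-sets) and $\mathbb{Q}B(G)=\mathbb{Q}\otimes_{\mathbb{Z}}B(G)$. $[X]$ denotes the class of a finite $G$-set $X$. The order of $g\in G$ is denoted $o(g)$. $[s_G]$ is a set of representatives of the conjugacy classes of subgroups of $G$. For $H\le G$, the element $e^G_H\in\mathbb{Q}B(G)$ is $$e^G_H=\frac{1}{|N_G(H)|}\sum_{K\le H}|K|\,\mu_G(K,H)\,[G/K],$$ where $\mu_G$ is the Möbius function of the poset of subgroups of $G$. It depends only on the conjugacy class of $H$, and the $e^G_H$ for $H\in[s_G]$ are the primitive idempotents of $\mathbb{Q}B(G)$. For a normal subgroup $N$ of $G$, the deflation map $\mathrm{Def}^G_{G/N}:\mathbb{Q}B(G)\to\mathbb{Q}B(G/N)$ is the $\mathbb{Q}$-linear map sending $[X]$ to $[N\backslash X]$, where $N\backslash X$ is the set of $N$-orbits on $X$ with its natural $G/N$-action. For any finite group $L$, the map $\mathbb{Q}B(L)\to\mathbb{Q}$, $\alpha\mapsto|\alpha|$, is the $\mathbb{Q}$-algebra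 homomorphism extending $[X]\mapsto|X|$ (cardinality). Thus $\alpha\mapsto G\backslash\alpha=|\mathrm{Def}^G_{G/G}(\alpha)|$ is the $\mathbb{Q}$-linear map sending $[X]$ to the number of $G$-orbits on $X$. *)

theory Defs
  imports "HOL-Algebra.Algebra" "HOL-Algebra.Algebraic_Closure_Type"
begin

section \<open>Finite sets with an action\<close>

type_synonym ('g, 'x) gset = "'x set \<times> ('g \<Rightarrow> 'x \<Rightarrow> 'x)"

definition finite_gset :: "('g, 'm) monoid_scheme \<Rightarrow> ('g, 'x) gset \<Rightarrow> bool"
  where "finite_gset G E \<longleftrightarrow> finite (fst E) \<and> group_action G (fst E) (snd E)"

definition gset_iso :: "('g, 'm) monoid_scheme \<Rightarrow> ('g, 'x) gset \<Rightarrow> ('g, 'y) gset \<Rightarrow> bool"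
  where "gset_iso G E F \<longleftrightarrow>
    (\<exists>f. bij_betw f (fst E) (fst F) \<and>
         (\<forall>g\<in>carrier G. \<forall>x\<in>fst E. f (snd E g x) = snd F g (f x)))"

text \<open>The isomorphism class of a finite G-set on an arbitrary type is represented by the set of
  all its copies living on finite sets of natural numbers; every finite G-set has such copies.\<close>

type_synonym 'g gclass = "('g, nat) gset set"

definition gset_class :: "('g, 'm) monoid_scheme \<Rightarrow> ('g, 'x) gset \<Rightarrow> 'g gclass"
  where "gset_class G E = {F. finite_gset G F \<and> gset_iso G E F}"

definition gset_sum :: "('g, 'x) gset \<Rightarrow> ('g, 'y) gset \<Rightarrow> ('g, 'x + 'y) gset"
  where "gset_sum E F =
    (Sum_Type.Plus (fst E) (fst F), \<lambda>g. restrict (map_sum (snd E g) (snd F g)) (Sum_Type.Plus (fst E) (fst F)))"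

definition gset_prod :: "('g, 'x) gset \<Rightarrow> ('g, 'y) gset \<Rightarrow> ('g, 'x \<times> 'y) gset"
  where "gset_prod E F =
    (fst E \<times> fst F, \<lambda>g. restrict (map_prod (snd E g) (snd F g)) (fst E \<times> fst F))"

definition gset_point :: "('g, unit) gset"
  where "gset_point = (UNIV, \<lambda>g x. x)"

definition coset_gset :: "('g, 'm) monoid_scheme \<Rightarrow> 'g set \<Rightarrow> ('g, 'g set) gset"
  where "coset_gset G K =
    (lcosets\<^bsub>G\<^esub> K, \<lambda>g. restrict (\<lambda>C. g <#\<^bsub>G\<^esub> C) (lcosets\<^bsub>G\<^esub> K))"

text \<open>The set of N-orbits with its action of the quotient group: a coset C of N sends an
  N-orbit P to the N-orbit consisting of all products of elements of C with elements of P.\<close>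

definition orbit_gset :: "('g, 'm) monoid_scheme \<Rightarrow> 'g set \<Rightarrow> ('g, 'x) gset \<Rightarrow> ('g set, 'x set) gset"
  where "orbit_gset G N E =
    (orbits (G\<lparr>carrier := N\<rparr>) (fst E) (snd E),
     \<lambda>C. restrict (\<lambda>P. \<Union>g\<in>C. snd E g ` P) (orbits (G\<lparr>carrier := N\<rparr>) (fst E) (snd E)))"


section \<open>Rings presented by a multiplicative monoid and additive relations\<close>

definition monoid_ring :: "('s, 'm) monoid_scheme \<Rightarrow> ('s \<Rightarrow>\<^sub>0 int) ring"
  where "monoid_ring M =
    \<lparr>carrier = carrier (free_Abelian_group (carrier M)),
     monoid.mult = (\<lambda>x y. frag_extend (\<lambda>s. frag_extend (\<lambda>t. frag_of (s \<otimes>\<^bsub>M\<^esub> t)) y) x),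
     one = frag_of \<one>\<^bsub>M\<^esub>, ring.zero = 0, add = (+)\<rparr>"

text \<open>Each triple \<open>(a, b, c)\<close> of generators stands for the relation \<open>a = b + c\<close>.  The relations are
  imposed additively; the subgroup they generate is an ideal as soon as the set of triples is closed
  under multiplication by M (locale \<open>presentation\<close> below), which holds in both uses made of it.\<close>

definition relation_subgroup ::
    "('s, 'm) monoid_scheme \<Rightarrow> ('s \<times> 's \<times> 's) set \<Rightarrow> ('s \<Rightarrow>\<^sub>0 int) set"
  where "relation_subgroup M T =
    generate (free_Abelian_group (carrier M))
      {frag_of a - frag_of b - frag_of c |a b c. (a, b, c) \<in> T}"

definition presented_ring ::
    "('s, 'm) monoid_scheme \<Rightarrow> ('s \<times> 's \<times> 's) set \<Rightarrow> ('s \<Rightarrow>\<^sub>0 int) set ring"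
  where "presented_ring M T = monoid_ring M Quot relation_subgroup M T"

definition presented_gen ::
    "('s, 'm) monoid_scheme \<Rightarrow> ('s \<times> 's \<times> 's) set \<Rightarrow> 's \<Rightarrow> ('s \<Rightarrow>\<^sub>0 int) set"
  where "presented_gen M T s = relation_subgroup M T +>\<^bsub>monoid_ring M\<^esub> frag_of s"


section \<open>The Burnside ring\<close>

definition gclass_monoid :: "('g, 'm) monoid_scheme \<Rightarrow> 'g gclass monoid"
  where "gclass_monoid G =
    \<lparr>carrier = {gset_class G E |E :: ('g, nat) gset. finite_gset G E},
     monoid.mult = (\<lambda>A B. \<Union>E\<in>A. \<Union>F\<in>B. gset_class G (gset_prod E F)),
     one = gset_class G gset_point\<rparr>"

definition burnside_relations ::
    "('g, 'm) monoid_scheme \<Rightarrow> ('g gclass \<times> 'g gclass \<times> 'g gclass) set"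
  where "burnside_relations G =
    {(gset_class G (gset_sum E F), gset_class G E, gset_class G F) |(E :: ('g, nat) gset) (F :: ('g, nat) gset).
       finite_gset G E \<and> finite_gset G F}"

type_synonym 'g burnside = "('g gclass \<Rightarrow>\<^sub>0 int) set"

definition burnside_ring :: "('g, 'm) monoid_scheme \<Rightarrow> 'g burnside ring"
  where "burnside_ring G = presented_ring (gclass_monoid G) (burnside_relations G)"

definition burnside_class :: "('g, 'm) monoid_scheme \<Rightarrow> ('g, 'x) gset \<Rightarrow> 'g burnside"
  where "burnside_class G E = presented_gen (gclass_monoid G) (burnside_relations G) (gset_class G E)"


section \<open>Extension of scalars to the rationals\<close>

abbreviation rat_ring :: "rat ring"
  where "rat_ring \<equiv> ring_of_type_algebra"

definition rat_self_algebra :: "(rat, rat) module"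
  where "rat_self_algebra = ring.extend rat_ring \<lparr>module.smult = (*)\<rparr>"

text \<open>The tensor product of the rationals with A over the integers: generators are the pure
  tensors \<open>(q, a)\<close>, multiplied componentwise, and the relations are those of biadditivity.\<close>

definition tensor_relations ::
    "('a, 'm) ring_scheme \<Rightarrow> ((rat \<times> 'a) \<times> (rat \<times> 'a) \<times> (rat \<times> 'a)) set"
  where "tensor_relations A =
    {((p + q, a), (p, a), (q, a)) |p q a. a \<in> carrier A} \<union>
    {((q, a \<oplus>\<^bsub>A\<^esub> b), (q, a), (q, b)) |q a b. a \<in> carrier A \<and> b \<in> carrier A}"

definition pure_tensor :: "('a, 'm) ring_scheme \<Rightarrow> rat \<Rightarrow> 'a \<Rightarrow> (rat \<times> 'a \<Rightarrow>\<^sub>0 int) set"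
  where "pure_tensor A q a = presented_gen (rat_ring \<times>\<times> A) (tensor_relations A) (q, a)"

definition rat_tensor :: "('a, 'm) ring_scheme \<Rightarrow> (rat, (rat \<times> 'a \<Rightarrow>\<^sub>0 int) set) module"
  where "rat_tensor A =
    (let T = presented_ring (rat_ring \<times>\<times> A) (tensor_relations A)
     in ring.extend T \<lparr>module.smult = (\<lambda>q x. pure_tensor A q \<one>\<^bsub>A\<^esub> \<otimes>\<^bsub>T\<^esub> x)\<rparr>)"

definition linear_maps ::
    "('r, 'x) ring_scheme \<Rightarrow> ('r, 'a, 'm) module_scheme \<Rightarrow> ('r, 'b, 'n) module_scheme \<Rightarrow> ('a \<Rightarrow> 'b) set"
  where "linear_maps R M N =
    {f \<in> carrier M \<rightarrow> carrier N.
      (\<forall>x\<in>carrier M. \<forall>y\<in>carrier M. f (x \<oplus>\<^bsub>M\<^esub> y) = f x \<oplus>\<^bsub>N\<^esub> f y) \<and>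
      (\<forall>r\<in>carrier R. \<forall>x\<in>carrier M. f (r \<odot>\<^bsub>M\<^esub> x) = r \<odot>\<^bsub>N\<^esub> f x)}"

type_synonym 'g rat_burnside = "(rat \<times> 'g burnside \<Rightarrow>\<^sub>0 int) set"

definition rat_burnside_ring :: "('g, 'm) monoid_scheme \<Rightarrow> (rat, 'g rat_burnside) module"
  where "rat_burnside_ring G = rat_tensor (burnside_ring G)"

definition rat_burnside_class :: "('g, 'm) monoid_scheme \<Rightarrow> ('g, 'x) gset \<Rightarrow> 'g rat_burnside"
  where "rat_burnside_class G E = pure_tensor (burnside_ring G) 1 (burnside_class G E)"


section \<open>Cardinality and deflation\<close>

text \<open>Requiring maps to be \<^const>\<open>extensional\<close> fixes their irrelevant values outside the carrier, which
  makes the descriptions below unique.  The maps described exist: see \<open>burnside_card_ex1\<close> and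
  \<open>deflation_ex1\<close>.\<close>

definition burnside_card :: "('g, 'm) monoid_scheme \<Rightarrow> 'g rat_burnside \<Rightarrow> rat"
  where "burnside_card L =
    (THE c. c \<in> extensional (carrier (rat_burnside_ring L)) \<and>
            c \<in> ring_hom (rat_burnside_ring L) rat_self_algebra \<and>
            c \<in> linear_maps rat_ring (rat_burnside_ring L) rat_self_algebra \<and>
            (\<forall>E :: ('g, nat) gset. finite_gset L E \<longrightarrow>
               c (rat_burnside_class L E) = of_nat (card (fst E))))"

definition deflation :: "('g, 'm) monoid_scheme \<Rightarrow> 'g set \<Rightarrow> 'g rat_burnside \<Rightarrow> 'g set rat_burnside"
  where "deflation G N =
    (THE d. d \<in> extensional (carrier (rat_burnside_ring G)) \<and>
            d \<in> linear_maps rat_ring (rat_burnside_ring G) (rat_burnside_ring (G Mod N)) \<and>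
            (\<forall>E :: ('g, nat) gset. finite_gset G E \<longrightarrow>
               d (rat_burnside_class G E) = rat_burnside_class (G Mod N) (orbit_gset G N E)))"

definition orbit_number :: "('g, 'm) monoid_scheme \<Rightarrow> 'g rat_burnside \<Rightarrow> rat"
  where "orbit_number G \<alpha> = burnside_card (G Mod carrier G) (deflation G (carrier G) \<alpha>)"


section \<open>Idempotents\<close>

function poset_mobius :: "'a :: order set \<Rightarrow> 'a \<Rightarrow> 'a \<Rightarrow> int"
  where "poset_mobius P x y =
    (if finite P \<and> x \<in> P \<and> y \<in> P \<and> x \<le> y
     then if x = y then 1 else - (\<Sum>z\<in>{z\<in>P. x \<le> z \<and> z < y}. poset_mobius P x z)
     else 0)"
  by auto
termination
  by (relation "measure (\<lambda>(P, x, y). card {z\<in>P. z < y})")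
     (auto intro!: psubset_card_mono)

declare poset_mobius.simps [simp del]

definition subgroup_mobius :: "('g, 'm) monoid_scheme \<Rightarrow> 'g set \<Rightarrow> 'g set \<Rightarrow> int"
  where "subgroup_mobius G K H = poset_mobius {H. subgroup H G} K H"

definition burnside_idempotent :: "('g, 'm) monoid_scheme \<Rightarrow> 'g set \<Rightarrow> 'g rat_burnside"
  where "burnside_idempotent G H =
    (1 / of_nat (card (normalizer G H))) \<odot>\<^bsub>rat_burnside_ring G\<^esub>
      (\<Oplus>\<^bsub>rat_burnside_ring G\<^esub> K\<in>{K. subgroup K G \<and> K \<subseteq> H}.
         (of_nat (card K) * of_int (subgroup_mobius G K H)) \<odot>\<^bsub>rat_burnside_ring G\<^esub>
           rat_burnside_class G (coset_gset G K))"

definition conjugate_subgroups :: "('g, 'm) monoid_scheme \<Rightarrow> 'g set \<Rightarrow> 'g set \<Rightarrow> bool"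
  where "conjugate_subgroups G H K \<longleftrightarrow> (\<exists>g\<in>carrier G. K = g <#\<^bsub>G\<^esub> H #>\<^bsub>G\<^esub> inv\<^bsub>G\<^esub> g)"

definition subgroup_class_reps :: "('g, 'm) monoid_scheme \<Rightarrow> 'g set set \<Rightarrow> bool"
  where "subgroup_class_reps G S \<longleftrightarrow>
    (\<forall>H\<in>S. subgroup H G) \<and>
    (\<forall>H. subgroup H G \<longrightarrow> (\<exists>!K. K \<in> S \<and> conjugate_subgroups G H K))"

definition burnside_sigma :: "('g, 'm) monoid_scheme \<Rightarrow> 'g set set \<Rightarrow> 'g rat_burnside"
  where "burnside_sigma G S =
    (\<Oplus>\<^bsub>rat_burnside_ring G\<^esub> H\<in>S.
       of_nat (card (rcosets\<^bsub>G\<^esub> H)) \<odot>\<^bsub>rat_burnside_ring G\<^esub> burnside_idempotent G H)"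

definition inverse_order_sum :: "('g, 'm) monoid_scheme \<Rightarrow> rat"
  where "inverse_order_sum G = (\<Sum>g\<in>carrier G. 1 / of_nat (group.ord G g))"


section \<open>The presented rings are rings\<close>

lemma monoid_ring_simps:
  "x \<in> carrier (monoid_ring M) \<longleftrightarrow> Poly_Mapping.keys x \<subseteq> carrier M"
  "x \<otimes>\<^bsub>monoid_ring M\<^esub> y = frag_extend (\<lambda>s. frag_extend (\<lambda>t. frag_of (s \<otimes>\<^bsub>M\<^esub> t)) y) x"
  "\<one>\<^bsub>monoid_ring M\<^esub> = frag_of \<one>\<^bsub>M\<^esub>"
  "\<zero>\<^bsub>monoid_ring M\<^esub> = 0"
  "x \<oplus>\<^bsub>monoid_ring M\<^esub> y = x + y"
  by (simp_all add: monoid_ring_def)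

lemma frag_extend_sub: "frag_extend (\<lambda>s. f s - g s) x = frag_extend f x - frag_extend g x"
  using subset_UNIV
  by (induction x rule: frag_induction) (auto simp: frag_extend_diff)

lemma frag_extend_plus: "frag_extend (\<lambda>s. f s + g s) x = frag_extend f x + frag_extend g x"
  using subset_UNIV
  by (induction x rule: frag_induction) (auto simp: frag_extend_diff)

lemma frag_extend_null [simp]: "frag_extend (\<lambda>s. 0) x = 0"
  by (rule frag_extend_eq_0) simp

abbreviation mr_mult where "mr_mult M x y \<equiv> frag_extend (\<lambda>s. frag_extend (\<lambda>t. frag_of (s \<otimes>\<^bsub>M\<^esub> t)) y) x"

lemma mr_bilin:
  "mr_mult M (a - b) y = mr_mult M a y - mr_mult M b y"
  "mr_mult M x (a - b) = mr_mult M x a - mr_mult M x b"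
  "mr_mult M (a + b) y = mr_mult M a y + mr_mult M b y"
  "mr_mult M x (a + b) = mr_mult M x a + mr_mult M x b"
  by (simp_all add: frag_extend_diff frag_extend_sub frag_extend_add frag_extend_plus)

lemma mr_keys:
  assumes "monoid M" "Poly_Mapping.keys x \<subseteq> carrier M" "Poly_Mapping.keys y \<subseteq> carrier M"
  shows "Poly_Mapping.keys (mr_mult M x y) \<subseteq> carrier M"
proof -
  have "Poly_Mapping.keys (frag_extend (\<lambda>t. frag_of (s \<otimes>\<^bsub>M\<^esub> t)) y) \<subseteq> carrier M" if "s \<in> carrier M" for s
    using keys_frag_extend[of "\<lambda>t. frag_of (s \<otimes>\<^bsub>M\<^esub> t)" y] assms that
    by (auto simp: monoid.m_closed subset_iff keys_frag_of)
  then show ?thesis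
    using keys_frag_extend[of "\<lambda>s. frag_extend (\<lambda>t. frag_of (s \<otimes>\<^bsub>M\<^esub> t)) y" x] assms by blast
qed

lemma (in comm_monoid) monoid_ring_cring: "cring (monoid_ring G)"
proof (rule cringI)
  show "abelian_group (monoid_ring G)"
  proof (rule abelian_groupI)
    fix x assume "x \<in> carrier (monoid_ring G)" 
    then show "\<exists>y\<in>carrier (monoid_ring G). y \<oplus>\<^bsub>monoid_ring G\<^esub> x = \<zero>\<^bsub>monoid_ring G\<^esub>"
      by (intro bexI[of _ "-x"]) (auto simp: monoid_ring_simps)
  next
    fix x y assume "x \<in> carrier (monoid_ring G)" "y \<in> carrier (monoid_ring G)"
    then show "x \<oplus>\<^bsub>monoid_ring G\<^esub> y \<in> carrier (monoid_ring G)"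
      unfolding monoid_ring_simps using keys_add[of x y] by blast
  qed (simp_all add: monoid_ring_simps algebra_simps)
  have comm: "mr_mult G x y = mr_mult G y x"
    if x: "Poly_Mapping.keys x \<subseteq> carrier G" and y: "Poly_Mapping.keys y \<subseteq> carrier G" for x y
    using x
  proof (induction x rule: frag_induction)
    case (one a)
    show ?case using y
    by (induction y rule: frag_induction) (auto simp: frag_extend_sub frag_extend_diff m_comm one)
  qed (auto simp: frag_extend_sub frag_extend_diff)
  have assoc: "mr_mult G (mr_mult G x y) z = mr_mult G x (mr_mult G y z)"
    if x: "Poly_Mapping.keys x \<subseteq> carrier G" and y: "Poly_Mapping.keys y \<subseteq> carrier G"
       and z: "Poly_Mapping.keys z \<subseteq> carrier G" for x y z
    using x
  proof (induction x rule: frag_induction)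
    case (one a)
    show ?case using y
    proof (induction y rule: frag_induction)
      case (one b)
      show ?case using z
        by (induction z rule: frag_induction)
           (auto simp: frag_extend_sub frag_extend_diff m_assoc one \<open>a \<in> carrier G\<close>)
    qed (auto simp: frag_extend_sub frag_extend_diff)
  qed (auto simp: frag_extend_sub frag_extend_diff)
  show "Group.comm_monoid (monoid_ring G)"
  proof (rule comm_monoidI)
    fix x assume "x \<in> carrier (monoid_ring G)"
    then have "Poly_Mapping.keys x \<subseteq> carrier G" by (simp add: monoid_ring_simps)
    then have "frag_extend (\<lambda>t. frag_of (\<one> \<otimes> t)) x = frag_extend frag_of x"
      by (intro frag_extend_eq) auto
    then show "\<one>\<^bsub>monoid_ring G\<^esub> \<otimes>\<^bsub>monoid_ring G\<^esub> x = x"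
      by (simp add: monoid_ring_simps flip: frag_expansion)
  next
    fix x y assume "x \<in> carrier (monoid_ring G)" "y \<in> carrier (monoid_ring G)"
    then show "x \<otimes>\<^bsub>monoid_ring G\<^esub> y \<in> carrier (monoid_ring G)"
      unfolding monoid_ring_simps by (rule mr_keys[OF monoid_axioms])
  next
    fix x y assume "x \<in> carrier (monoid_ring G)" "y \<in> carrier (monoid_ring G)"
    then show "x \<otimes>\<^bsub>monoid_ring G\<^esub> y = y \<otimes>\<^bsub>monoid_ring G\<^esub> x"
      unfolding monoid_ring_simps by (rule comm)
  next
    fix x y z assume "x \<in> carrier (monoid_ring G)" "y \<in> carrier (monoid_ring G)" "z \<in> carrier (monoid_ring G)"
    then show "x \<otimes>\<^bsub>monoid_ring G\<^esub> y \<otimes>\<^bsub>monoid_ring G\<^esub> z = x \<otimes>\<^bsub>monoid_ring G\<^esub> (y \<otimes>\<^bsub>monoid_ring G\<^esub> z)"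
      unfolding monoid_ring_simps by (rule assoc)
  qed (simp add: monoid_ring_simps)
qed (simp add: monoid_ring_simps mr_bilin)

locale presentation = comm_monoid M for M (structure) +
  fixes T
  assumes T_carrier: "(a, b, c) \<in> T \<Longrightarrow> a \<in> carrier M \<and> b \<in> carrier M \<and> c \<in> carrier M"
    and T_mult: "(a, b, c) \<in> T \<Longrightarrow> s \<in> carrier M \<Longrightarrow> (s \<otimes> a, s \<otimes> b, s \<otimes> c) \<in> T"
begin

abbreviation "I \<equiv> relation_subgroup M T"
abbreviation "P \<equiv> presented_ring M T"
abbreviation "gen \<equiv> presented_gen M T"

lemma rels_carrier: "{frag_of a - frag_of b - frag_of c |a b c. (a, b, c) \<in> T} \<subseteq> carrier (free_Abelian_group (carrier M))"
proof -
  have "Poly_Mapping.keys (frag_of a - frag_of b - frag_of c) \<subseteq> carrier M" if "(a,b,c) \<in> T" for a b c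
    using T_carrier[OF that] keys_diff[of "frag_of a - frag_of b" "frag_of c"] keys_diff[of "frag_of a" "frag_of b"]
    by auto
  then show ?thesis by auto
qed

lemma I_subgroup: "subgroup I (free_Abelian_group (carrier M))"
  unfolding relation_subgroup_def
  by (rule group.generate_is_subgroup[OF _ rels_carrier]) simp

lemma I_keys: "x \<in> I \<Longrightarrow> Poly_Mapping.keys x \<subseteq> carrier M"
  using subgroup.mem_carrier[OF I_subgroup] by simp

lemma I_ideal_aux: "x \<in> I \<Longrightarrow> Poly_Mapping.keys y \<subseteq> carrier M \<Longrightarrow> mr_mult M y x \<in> I"
proof -
  assume x: "x \<in> I" and y: "Poly_Mapping.keys y \<subseteq> carrier M"
  have d: "u - v \<in> I" if "u \<in> I" "v \<in> I" for u v
  proof -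
    have "-v \<in> I"
      using subgroup.m_inv_closed[OF I_subgroup that(2)] I_keys[OF that(2)] by simp
    with subgroup.m_closed[OF I_subgroup that(1)] show ?thesis by force
  qed
  have z: "0 \<in> I" using subgroup.one_closed[OF I_subgroup] by simp
  show ?thesis using y
  proof (induction y rule: frag_induction)
    case (one s)
    have "frag_extend (\<lambda>t. frag_of (s \<otimes> t)) x \<in> I"
      using x unfolding relation_subgroup_def
    proof (induction rule: generate.induct)
      case (incl h)
      then obtain a b c where h: "h = frag_of a - frag_of b - frag_of c" "(a,b,c) \<in> T" by auto
      then show ?case using T_mult[OF h(2) one]
        by (auto simp: frag_extend_diff intro!: generate.incl)
    next
      case (inv h)
      then obtain a b c where h: "h = frag_of a - frag_of b - frag_of c" "(a,b,c) \<in> T" by auto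
      have k: "Poly_Mapping.keys h \<subseteq> carrier M" using inv rels_carrier by force
      have "frag_extend (\<lambda>t. frag_of (s \<otimes> t)) h \<in> I"
        unfolding relation_subgroup_def
        using T_mult[OF h(2) one] h
        by (auto simp: frag_extend_diff intro!: generate.incl)
      from d[OF z this] show ?case using k 
        by (simp add: frag_extend_minus relation_subgroup_def)
    next
      case (eng h1 h2)
      show ?case using generate.eng[OF eng(3,4)] by (simp add: frag_extend_add)
    qed (use z in \<open>auto simp: relation_subgroup_def\<close>)
    then show ?case by simp
  qed (auto simp: z frag_extend_diff d)
qed

lemma add_monoid_mr: "add_monoid (monoid_ring M) = free_Abelian_group (carrier M)"
  by (simp add: monoid_ring_def free_Abelian_group_def)

lemma I_ideal: "ideal I (monoid_ring M)"
proof -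
  interpret C: cring "monoid_ring M" by (rule monoid_ring_cring)
  show ?thesis
  proof (rule idealI)
    show "subgroup I (add_monoid (monoid_ring M))"
      by (subst add_monoid_mr) (rule I_subgroup)
    fix a x assume a: "a \<in> I" and x: "x \<in> carrier (monoid_ring M)"
    show 1: "x \<otimes>\<^bsub>monoid_ring M\<^esub> a \<in> I"
      using I_ideal_aux[OF a] x by (simp add: monoid_ring_simps)
    show "a \<otimes>\<^bsub>monoid_ring M\<^esub> x \<in> I"
      using 1 C.m_comm[of a x] x I_keys[OF a] by (simp add: monoid_ring_simps(1))
  qed (rule C.ring_axioms)
qed

sublocale I: ideal I "monoid_ring M" by (rule I_ideal)

lemma P_cring: "cring P"
  unfolding presented_ring_def by (rule I.quotient_is_cring[OF monoid_ring_cring])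

sublocale P: cring P by (rule P_cring)

abbreviation "cls \<equiv> (\<lambda>x. I +>\<^bsub>monoid_ring M\<^esub> x)"

lemma cls_hom: "cls \<in> ring_hom (monoid_ring M) P"
  unfolding presented_ring_def by (rule I.rcos_ring_hom)

lemma gen_cls: "gen s = cls (frag_of s)" by (simp add: presented_gen_def)

lemma carrier_P: "carrier P = cls ` carrier (monoid_ring M)"
  by (auto simp: presented_ring_def FactRing_def A_RCOSETS_def RCOSETS_def a_r_coset_def)

lemma gen_closed [simp]: "s \<in> carrier M \<Longrightarrow> gen s \<in> carrier P"
  by (auto simp: gen_cls carrier_P monoid_ring_simps)

lemma gen_mult: "s \<in> carrier M \<Longrightarrow> t \<in> carrier M \<Longrightarrow> gen s \<otimes>\<^bsub>P\<^esub> gen t = gen (s \<otimes> t)"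
  using ring_hom_mult[OF cls_hom, of "frag_of s" "frag_of t"]
  by (simp add: gen_cls monoid_ring_simps)

lemma gen_one: "gen \<one> = \<one>\<^bsub>P\<^esub>"
  using ring_hom_one[OF cls_hom] by (simp add: gen_cls monoid_ring_simps)

lemma cls_diff:
  assumes "Poly_Mapping.keys x \<subseteq> carrier M" "Poly_Mapping.keys y \<subseteq> carrier M"
  shows "cls (x - y) = cls x \<ominus>\<^bsub>P\<^esub> cls y"
proof -
  have k: "Poly_Mapping.keys (x - y) \<subseteq> carrier M" using assms by (metis Un_least keys_diff order_trans)
  then have "cls (x - y) \<oplus>\<^bsub>P\<^esub> cls y = cls x"
    using ring_hom_add[OF cls_hom, of "x - y" y] assms by (simp add: monoid_ring_simps)
  moreover have "cls x \<in> carrier P" "cls y \<in> carrier P" "cls (x - y) \<in> carrier P"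
    using assms k by (auto simp: carrier_P monoid_ring_simps)
  ultimately show ?thesis
    by (metis P.add.inv_solve_right P.minus_eq)
qed

lemma P_induct [consumes 1, case_names zero gen diff]:
  assumes x: "x \<in> carrier P"
    and z: "Q \<zero>\<^bsub>P\<^esub>" and g: "\<And>s. s \<in> carrier M \<Longrightarrow> Q (gen s)"
    and d: "\<And>u v. u \<in> carrier P \<Longrightarrow> v \<in> carrier P \<Longrightarrow> Q u \<Longrightarrow> Q v \<Longrightarrow> Q (u \<ominus>\<^bsub>P\<^esub> v)"
  shows "Q x"
proof -
  obtain y where y: "Poly_Mapping.keys y \<subseteq> carrier M" "x = cls y"
    using x by (auto simp: carrier_P monoid_ring_simps)
  have "Q (cls y)" using y(1)
  proof (rule free_Abelian_group_induct)
    have "\<zero>\<^bsub>P\<^esub> = cls 0"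
    proof -
      have "cls (frag_of \<one> - frag_of \<one>) = \<zero>\<^bsub>P\<^esub>"
        by (subst cls_diff) (auto simp flip: gen_cls)
      then show ?thesis by simp
    qed
    then show "Q (cls 0)" using z by simp
  next
    fix a b assume "Poly_Mapping.keys a \<subseteq> carrier M" "Poly_Mapping.keys b \<subseteq> carrier M" "Q (cls a)" "Q (cls b)"
    then show "Q (cls (a - b))"
      by (subst cls_diff) (auto intro!: d simp: carrier_P monoid_ring_simps)
  next
    fix a assume "a \<in> carrier M" then show "Q (cls (frag_of a))" using g by (simp flip: gen_cls)
  qed
  then show ?thesis using y by simp
qed

lemma abel_aux:
  assumes "x \<in> carrier P" "y \<in> carrier P" "z \<in> carrier P" "(x \<ominus>\<^bsub>P\<^esub> y) \<ominus>\<^bsub>P\<^esub> z = \<zero>\<^bsub>P\<^esub>"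
  shows "x = y \<oplus>\<^bsub>P\<^esub> z"
proof -
  have "x = ((x \<ominus>\<^bsub>P\<^esub> y) \<ominus>\<^bsub>P\<^esub> z) \<oplus>\<^bsub>P\<^esub> (y \<oplus>\<^bsub>P\<^esub> z)"
    using assms(1-3) by algebra
  then show ?thesis using assms by simp
qed

lemma gen_rel:
  assumes "(a, b, c) \<in> T" shows "gen a = gen b \<oplus>\<^bsub>P\<^esub> gen c"
proof -
  note abc = T_carrier[OF assms]
  let ?r = "frag_of a - frag_of b - frag_of c"
  have r: "?r \<in> I" unfolding relation_subgroup_def using assms by (blast intro: generate.incl)
  have k: "Poly_Mapping.keys (frag_of a - frag_of b) \<subseteq> carrier M" 
    using abc keys_diff[of "frag_of a" "frag_of b"] by auto
  have "cls ?r = \<zero>\<^bsub>P\<^esub>"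
    using I.a_rcos_const[OF r] by (simp add: presented_ring_def FactRing_def)
  then have "(gen a \<ominus>\<^bsub>P\<^esub> gen b) \<ominus>\<^bsub>P\<^esub> gen c = \<zero>\<^bsub>P\<^esub>"
    using abc k by (simp add: cls_diff gen_cls)
  then show ?thesis
    using abc abel_aux[of "gen a" "gen b" "gen c"] by simp
qed

lemma additive_diff:
  assumes A: "abelian_group A"
    and f: "f \<in> carrier P \<rightarrow> carrier A" "\<And>x y. x \<in> carrier P \<Longrightarrow> y \<in> carrier P \<Longrightarrow> f (x \<oplus>\<^bsub>P\<^esub> y) = f x \<oplus>\<^bsub>A\<^esub> f y"
  shows "f \<zero>\<^bsub>P\<^esub> = \<zero>\<^bsub>A\<^esub>"
    and "x \<in> carrier P \<Longrightarrow> y \<in> carrier P \<Longrightarrow> f (x \<ominus>\<^bsub>P\<^esub> y) = f x \<ominus>\<^bsub>A\<^esub> f y"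
proof -
  interpret A: abelian_group A by fact
  have c: "f x \<in> carrier A" if "x \<in> carrier P" for x using f(1) that by auto
  show "f \<zero>\<^bsub>P\<^esub> = \<zero>\<^bsub>A\<^esub>"
    using f(2)[of "\<zero>\<^bsub>P\<^esub>" "\<zero>\<^bsub>P\<^esub>"] c[of "\<zero>\<^bsub>P\<^esub>"] A.add.r_cancel_one'[of "f \<zero>\<^bsub>P\<^esub>" "f \<zero>\<^bsub>P\<^esub>"] by simp
  assume xy: "x \<in> carrier P" "y \<in> carrier P"
  have "(x \<ominus>\<^bsub>P\<^esub> y) \<oplus>\<^bsub>P\<^esub> y = x" using xy by algebra
  then have "f x = f (x \<ominus>\<^bsub>P\<^esub> y) \<oplus>\<^bsub>A\<^esub> f y" using f(2)[of "x \<ominus>\<^bsub>P\<^esub> y" y] xy by simp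
  then show "f (x \<ominus>\<^bsub>P\<^esub> y) = f x \<ominus>\<^bsub>A\<^esub> f y"
    using A.add.inv_solve_right[of "f (x \<ominus>\<^bsub>P\<^esub> y)" "f x" "f y"] c xy by (simp add: A.minus_eq)
qed

lemma additive_ext:
  assumes A: "abelian_group A"
    and f: "f \<in> carrier P \<rightarrow> carrier A" "\<And>x y. x \<in> carrier P \<Longrightarrow> y \<in> carrier P \<Longrightarrow> f (x \<oplus>\<^bsub>P\<^esub> y) = f x \<oplus>\<^bsub>A\<^esub> f y"
    and g: "g \<in> carrier P \<rightarrow> carrier A" "\<And>x y. x \<in> carrier P \<Longrightarrow> y \<in> carrier P \<Longrightarrow> g (x \<oplus>\<^bsub>P\<^esub> y) = g x \<oplus>\<^bsub>A\<^esub> g y"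
    and eq: "\<And>s. s \<in> carrier M \<Longrightarrow> f (gen s) = g (gen s)"
    and x: "x \<in> carrier P"
  shows "f x = g x"
  using x by (induction rule: P_induct) (simp_all add: eq additive_diff[OF A f] additive_diff[OF A g])

lemma lift_mult:
  assumes A: "cring A"
    and h: "h \<in> carrier P \<rightarrow> carrier A" "\<And>x y. x \<in> carrier P \<Longrightarrow> y \<in> carrier P \<Longrightarrow> h (x \<oplus>\<^bsub>P\<^esub> y) = h x \<oplus>\<^bsub>A\<^esub> h y"
    and m: "\<And>s t. s \<in> carrier M \<Longrightarrow> t \<in> carrier M \<Longrightarrow> h (gen (s \<otimes> t)) = h (gen s) \<otimes>\<^bsub>A\<^esub> h (gen t)"
    and o: "h (gen \<one>) = \<one>\<^bsub>A\<^esub>"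
  shows "h \<in> ring_hom P A"
proof (rule ring_hom_memI)
  interpret A: cring A by fact
  note A' = A.abelian_group_axioms
  have c: "h x \<in> carrier A" if "x \<in> carrier P" for x using h(1) that by auto
  show "h (x \<otimes>\<^bsub>P\<^esub> y) = h x \<otimes>\<^bsub>A\<^esub> h y" if x: "x \<in> carrier P" and y: "y \<in> carrier P" for x y
  proof (rule additive_ext[OF A' _ _ _ _ _ x, where f = "\<lambda>x. h (x \<otimes>\<^bsub>P\<^esub> y)" and g = "\<lambda>x. h x \<otimes>\<^bsub>A\<^esub> h y"])
    fix s assume s: "s \<in> carrier M"
    show "h (gen s \<otimes>\<^bsub>P\<^esub> y) = h (gen s) \<otimes>\<^bsub>A\<^esub> h y"
      by (rule additive_ext[OF A' _ _ _ _ _ y, where f = "\<lambda>y. h (gen s \<otimes>\<^bsub>P\<^esub> y)" and g = "\<lambda>y. h (gen s) \<otimes>\<^bsub>A\<^esub> h y"])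
        (use s in \<open>auto simp: c h(2) P.r_distr A.r_distr gen_mult m\<close>)
  qed (use y in \<open>auto simp: c h(2) P.l_distr A.l_distr\<close>)
  show "h \<one>\<^bsub>P\<^esub> = \<one>\<^bsub>A\<^esub>" using o by (simp add: gen_one)
qed (use h in auto)

lemma lift:
  assumes A: "abelian_group A"
    and f: "\<And>s. s \<in> carrier M \<Longrightarrow> f s \<in> carrier A"
    and T: "\<And>a b c. (a, b, c) \<in> T \<Longrightarrow> f a = f b \<oplus>\<^bsub>A\<^esub> f c"
  obtains h where "h \<in> carrier P \<rightarrow> carrier A"
    "\<And>x y. x \<in> carrier P \<Longrightarrow> y \<in> carrier P \<Longrightarrow> h (x \<oplus>\<^bsub>P\<^esub> y) = h x \<oplus>\<^bsub>A\<^esub> h y"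
    "\<And>s. s \<in> carrier M \<Longrightarrow> h (gen s) = f s"
proof -
  interpret A: abelian_group A by fact
  let ?F = "free_Abelian_group (carrier M)"
  have fim: "f ` carrier M \<subseteq> carrier (add_monoid A)" using f by auto
  obtain g where g: "g \<in> hom ?F (add_monoid A)" "\<And>s. s \<in> carrier M \<Longrightarrow> g (frag_of s) = f s"
    using comm_group.free_Abelian_group_universal[OF A.a_comm_group fim] by blast
  interpret g: group_hom ?F "add_monoid A" g
    using g by (simp add: group_hom_def group_hom_axioms_def A.add.is_group)
  have gI: "I \<subseteq> kernel ?F (add_monoid A) g"
    unfolding relation_subgroup_def
  proof (rule group.generate_subgroup_incl[OF _ _ g.subgroup_kernel])
    show "{frag_of a - frag_of b - frag_of c |a b c. (a, b, c) \<in> T} \<subseteq> kernel ?F (add_monoid A) g"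
    proof clarify
      fix a b c assume t: "(a, b, c) \<in> T"
      note abc = T_carrier[OF t]
      let ?r = "frag_of a - frag_of b - frag_of c"
      have kr: "?r \<in> carrier ?F" using rels_carrier t by blast
      have "g (?r \<otimes>\<^bsub>?F\<^esub> (frag_of b \<otimes>\<^bsub>?F\<^esub> frag_of c)) = g ?r \<oplus>\<^bsub>A\<^esub> (f b \<oplus>\<^bsub>A\<^esub> f c)"
      proof -
        have 2: "frag_of b \<otimes>\<^bsub>?F\<^esub> frag_of c \<in> carrier ?F"
          using abc by (intro group.subgroup_self[THEN subgroup.m_closed]) auto
        show ?thesis
          using g.hom_mult[OF kr 2] g.hom_mult[of "frag_of b" "frag_of c"] g(2) abc
          by (simp del: mult_free_Abelian_group)
      qed
      then have "f b \<oplus>\<^bsub>A\<^esub> f c = g ?r \<oplus>\<^bsub>A\<^esub> (f b \<oplus>\<^bsub>A\<^esub> f c)"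
        using g T[OF t] abc by simp
      moreover have "g ?r \<in> carrier A" using g.hom_closed[OF kr] by simp
      ultimately have "g ?r = \<zero>\<^bsub>A\<^esub>"
        using A.add.r_cancel_one'[of "f b \<oplus>\<^bsub>A\<^esub> f c" "g ?r"] f abc by simp
      then show "?r \<in> kernel ?F (add_monoid A) g" using kr by (simp add: kernel_def)
    qed
  qed simp
  have nI: "I \<lhd> ?F"
    by (simp add: comm_group.subgroup_imp_normal abelian_free_Abelian_group I_subgroup)
  have gI': "\<And>x y. \<lbrakk>x \<in> carrier ?F; y \<in> carrier ?F; I #>\<^bsub>?F\<^esub> x = I #>\<^bsub>?F\<^esub> y\<rbrakk> \<Longrightarrow> g x = g y"
  proof -
    fix x y assume x: "x \<in> carrier ?F" and y: "y \<in> carrier ?F" and e: "I #>\<^bsub>?F\<^esub> x = I #>\<^bsub>?F\<^esub> y"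
    have "x \<in> I #>\<^bsub>?F\<^esub> y" using group.rcos_self[OF group_free_Abelian_group x I_subgroup] e by simp
    then obtain i where "i \<in> I" "x = i \<otimes>\<^bsub>?F\<^esub> y" by (auto simp: r_coset_def)
    moreover from this have "g i = \<zero>\<^bsub>A\<^esub>" "i \<in> carrier ?F" using gI by (auto simp: kernel_def)
    ultimately show "g x = g y" using g.hom_mult[of i y] y g.hom_closed[OF y] by simp
  qed
  obtain h where h: "h \<in> hom (?F Mod I) (add_monoid A)" "\<And>x. x \<in> carrier ?F \<Longrightarrow> h (I #>\<^bsub>?F\<^esub> x) = g x"
    using FactGroup_universal[OF g(1) nI gI'] by blast
  have car: "carrier (?F Mod I) = carrier P" 
    by (simp add: presented_ring_def FactRing_def A_RCOSETS_def FactGroup_def flip: add_monoid_mr)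
  have mul: "x \<otimes>\<^bsub>?F Mod I\<^esub> y = x \<oplus>\<^bsub>P\<^esub> y" for x y
    by (simp add: presented_ring_def FactRing_def set_add_def FactGroup_def flip: add_monoid_mr)
  show ?thesis
  proof
    show "h \<in> carrier P \<rightarrow> carrier A" using h(1) by (auto simp: hom_def car)
    show "h (x \<oplus>\<^bsub>P\<^esub> y) = h x \<oplus>\<^bsub>A\<^esub> h y" if "x \<in> carrier P" "y \<in> carrier P" for x y
      using hom_mult[OF h(1), of x y, unfolded mul car] that by simp
    show "h (gen s) = f s" if "s \<in> carrier M" for s
      using h(2)[of "frag_of s"] g(2) that by (simp add: gen_cls a_r_coset_def monoid_ring_simps(1) flip: add_monoid_mr)
  qed
qed

end


section \<open>Isomorphism classes of finite sets with an action\<close>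

lemma finite_gsetI:
  assumes G: "Group.group G" and fin: "finite E"
    and ext: "\<And>g. g \<in> carrier G \<Longrightarrow> \<phi> g \<in> extensional E"
    and cl: "\<And>g x. g \<in> carrier G \<Longrightarrow> x \<in> E \<Longrightarrow> \<phi> g x \<in> E"
    and one: "\<And>x. x \<in> E \<Longrightarrow> \<phi> \<one>\<^bsub>G\<^esub> x = x"
    and mult: "\<And>g h x. g \<in> carrier G \<Longrightarrow> h \<in> carrier G \<Longrightarrow> x \<in> E \<Longrightarrow> \<phi> (g \<otimes>\<^bsub>G\<^esub> h) x = \<phi> g (\<phi> h x)"
  shows "finite_gset G (E, \<phi>)"
proof -
  interpret G: Group.group G by fact
  have bij: "\<phi> g \<in> Bij E" if g: "g \<in> carrier G" for g
  proof -
    have "bij_betw (\<phi> g) E E"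
    proof (rule bij_betw_byWitness[where f' = "\<phi> (inv\<^bsub>G\<^esub> g)"])
      show "\<forall>a\<in>E. \<phi> (inv\<^bsub>G\<^esub> g) (\<phi> g a) = a"
        using g one by (simp flip: mult)
      show "\<forall>a\<in>E. \<phi> g (\<phi> (inv\<^bsub>G\<^esub> g) a) = a"
        using g one by (simp flip: mult)
    qed (use g cl in auto)
    then show ?thesis using ext[OF g] by (simp add: Bij_def)
  qed
  have "\<phi> \<in> hom G (BijGroup E)"
  proof (rule homI)
    fix g h assume gh: "g \<in> carrier G" "h \<in> carrier G"
    have "\<phi> (g \<otimes>\<^bsub>G\<^esub> h) = compose E (\<phi> g) (\<phi> h)"
      using ext[of "g \<otimes>\<^bsub>G\<^esub> h"] gh mult
      by (intro extensionalityI[of _ E]) (auto simp: compose_def)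
    then show "\<phi> (g \<otimes>\<^bsub>G\<^esub> h) = \<phi> g \<otimes>\<^bsub>BijGroup E\<^esub> \<phi> h"
      using bij gh by (simp add: BijGroup_def)
  qed (simp add: BijGroup_def bij)
  then show ?thesis
    using fin G by (simp add: finite_gset_def group_action_def group_hom_def group_hom_axioms_def group_BijGroup)
qed

context
  fixes G :: "('g, 'm) monoid_scheme" (structure) and E :: "('g, 'x) gset"
  assumes E: "finite_gset G E"
begin

interpretation A: group_action G "fst E" "snd E" using E by (simp add: finite_gset_def)

lemma gset_group: "Group.group G"
  using A.group_hom by (simp add: group_hom_def)

lemma gset_finite: "finite (fst E)" using E by (simp add: finite_gset_def)

lemma gset_closed: "g \<in> carrier G \<Longrightarrow> x \<in> fst E \<Longrightarrow> snd E g x \<in> fst E"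
  by (rule A.element_image) auto

lemma gset_one: "x \<in> fst E \<Longrightarrow> snd E \<one> x = x"
  using A.id_eq_one by (metis restrict_apply')

lemma gset_mult: "g \<in> carrier G \<Longrightarrow> h \<in> carrier G \<Longrightarrow> x \<in> fst E \<Longrightarrow> snd E (g \<otimes> h) x = snd E g (snd E h x)"
  by (rule A.composition_rule)

lemma gset_iso_refl: "gset_iso G E E"
  unfolding gset_iso_def by (rule exI[of _ "\<lambda>x. x"]) (auto simp: bij_betw_def)

lemma gset_iso_sym: "gset_iso G E F \<Longrightarrow> gset_iso G F E"
proof -
  assume "gset_iso G E F"
  then obtain f where f: "bij_betw f (fst E) (fst F)"
    and eq: "\<And>g x. g \<in> carrier G \<Longrightarrow> x \<in> fst E \<Longrightarrow> f (snd E g x) = snd F g (f x)"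
    by (auto simp: gset_iso_def)
  let ?h = "inv_into (fst E) f"
  have "?h (snd F g y) = snd E g (?h y)" if g: "g \<in> carrier G" and y: "y \<in> fst F" for g y
  proof -
    have x: "?h y \<in> fst E" "f (?h y) = y"
      using f y by (auto simp: bij_betw_def inv_into_into f_inv_into_f)
    then show ?thesis
      using eq[OF g x(1)] gset_closed[OF g x(1)] f by (metis bij_betw_inv_into_left)
  qed
  then show ?thesis
    using bij_betw_inv_into[OF f] by (auto simp: gset_iso_def)
qed

lemma gset_transport:
  assumes f: "bij_betw f (fst E) B"
  defines "F \<equiv> (B, \<lambda>g. restrict (\<lambda>y. f (snd E g (inv_into (fst E) f y))) B)"
  shows "finite_gset G F" "gset_iso G E F"
proof -
  have i: "inv_into (fst E) f y \<in> fst E" "f (inv_into (fst E) f y) = y" if "y \<in> B" for y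
    using f that by (auto simp: bij_betw_def inv_into_into f_inv_into_f)
  have j: "inv_into (fst E) f (f x) = x" "f x \<in> B" if "x \<in> fst E" for x
    using f that by (auto simp: bij_betw_def)
  have "finite B" using f gset_finite by (metis bij_betw_finite)
  then show "finite_gset G F" unfolding F_def
    by (intro finite_gsetI gset_group) (auto simp: i j gset_closed gset_one gset_mult
        monoid.m_closed[OF group.is_monoid[OF gset_group]] monoid.one_closed[OF group.is_monoid[OF gset_group]])
  show "gset_iso G E F"
    unfolding gset_iso_def F_def using f by (auto intro!: exI[of _ f] simp: i j gset_closed)
qed

lemma gset_nat_copy: "\<exists>F :: ('g, nat) gset. finite_gset G F \<and> gset_iso G E F"
  using ex_bij_betw_finite_nat[OF gset_finite] gset_transport by blast

end

lemma gset_iso_trans: "gset_iso G E F \<Longrightarrow> gset_iso G F H \<Longrightarrow> gset_iso G E H"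
  unfolding gset_iso_def
proof clarify
  fix f h assume f: "bij_betw f (fst E) (fst F)" "\<forall>g\<in>carrier G. \<forall>x\<in>fst E. f (snd E g x) = snd F g (f x)"
   and h: "bij_betw h (fst F) (fst H)" "\<forall>g\<in>carrier G. \<forall>x\<in>fst F. h (snd F g x) = snd H g (h x)"
  show "\<exists>f. bij_betw f (fst E) (fst H) \<and>
         (\<forall>g\<in>carrier G. \<forall>x\<in>fst E. f (snd E g x) = snd H g (f x))"
    by (rule exI[of _ "h \<circ> f"]) (use f h bij_betw_trans[OF f(1) h(1)] in \<open>auto simp: bij_betw_apply\<close>)
qed

lemma gset_class_eq:
  assumes E: "finite_gset G E" and F: "finite_gset G F" and i: "gset_iso G E F"
  shows "gset_class G E = gset_class G F"
  unfolding gset_class_def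
proof (rule Collect_cong)
  fix H :: "('a, nat) gset"
  show "finite_gset G H \<and> gset_iso G E H \<longleftrightarrow> finite_gset G H \<and> gset_iso G F H"
    using gset_iso_trans[OF i, of H] gset_iso_trans[OF gset_iso_sym[OF E i], of H] by blast
qed

lemma gset_class_nonempty: "finite_gset G E \<Longrightarrow> \<exists>F. F \<in> gset_class G E"
  unfolding gset_class_def mem_Collect_eq by (rule gset_nat_copy)

lemma gset_class_eqD:
  assumes E: "finite_gset G E" and F: "finite_gset G F" and i: "gset_class G E = gset_class G F"
  shows "gset_iso G E F"
  using gset_class_nonempty[OF E] i gset_iso_trans gset_iso_sym[OF F] unfolding gset_class_def by blast

lemma gset_class_nat_rep:
  assumes "finite_gset G E"
  obtains F :: "('g, nat) gset" where "finite_gset G F" "gset_iso G E F" "gset_class G E = gset_class G F"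
  using gset_nat_copy[OF assms] gset_class_eq[OF assms] by metis

lemma gset_class_in: "finite_gset G E \<Longrightarrow> gset_class G E \<in> carrier (gclass_monoid G)"
  by (erule gset_class_nat_rep) (auto simp: gclass_monoid_def)

lemma gset_iso_card: "gset_iso G E F \<Longrightarrow> card (fst E) = card (fst F)"
  by (auto simp: gset_iso_def intro: bij_betw_same_card)

lemma finite_gset_prod:
  assumes E: "finite_gset G E" and F: "finite_gset G F"
  shows "finite_gset G (gset_prod E F)"
proof -
  interpret Group.group G by (rule gset_group[OF E])
  show ?thesis
  unfolding gset_prod_def
  by (rule finite_gsetI) (auto simp: gset_finite[OF E] gset_finite[OF F] 
       gset_closed[OF E] gset_closed[OF F] gset_one[OF E] gset_one[OF F] gset_mult[OF E] gset_mult[OF F])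
qed

lemma finite_gset_sum:
  assumes E: "finite_gset G E" and F: "finite_gset G F"
  shows "finite_gset G (gset_sum E F)"
proof -
  interpret Group.group G by (rule gset_group[OF E])
  show ?thesis
  unfolding gset_sum_def
  by (rule finite_gsetI) (auto simp: gset_finite[OF E] gset_finite[OF F] 
       gset_closed[OF E] gset_closed[OF F] gset_one[OF E] gset_one[OF F] gset_mult[OF E] gset_mult[OF F])
qed

lemma finite_gset_point: "Group.group G \<Longrightarrow> finite_gset G gset_point"
  unfolding gset_point_def by (rule finite_gsetI) auto

lemma gset_prod_iso:
  assumes "finite_gset G E" "finite_gset G F" "gset_iso G E E'" "gset_iso G F F'"
  shows "gset_iso G (gset_prod E F) (gset_prod E' F')"
proof -
  obtain f h where f: "bij_betw f (fst E) (fst E')" "\<forall>g\<in>carrier G. \<forall>x\<in>fst E. f (snd E g x) = snd E' g (f x)"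
   and h: "bij_betw h (fst F) (fst F')" "\<forall>g\<in>carrier G. \<forall>x\<in>fst F. h (snd F g x) = snd F' g (h x)"
    using assms(3,4) by (auto simp: gset_iso_def)
  show ?thesis
    unfolding gset_iso_def gset_prod_def
    by (rule exI[of _ "map_prod f h"])
       (use f h in \<open>auto simp: bij_betw_map_prod bij_betw_apply\<close>)
qed

lemma gset_sum_iso:
  assumes "finite_gset G E" "finite_gset G F" "gset_iso G E E'" "gset_iso G F F'"
  shows "gset_iso G (gset_sum E F) (gset_sum E' F')"
proof -
  obtain f h where f: "bij_betw f (fst E) (fst E')" "\<forall>g\<in>carrier G. \<forall>x\<in>fst E. f (snd E g x) = snd E' g (f x)"
   and h: "bij_betw h (fst F) (fst F')" "\<forall>g\<in>carrier G. \<forall>x\<in>fst F. h (snd F g x) = snd F' g (h x)"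
    using assms(3,4) by (auto simp: gset_iso_def)
  have "bij_betw (map_sum f h) (Sum_Type.Plus (fst E) (fst F)) (Sum_Type.Plus (fst E') (fst F'))"
  proof -
    have "map_sum f h ` (Sum_Type.Plus (fst E) (fst F)) = Sum_Type.Plus (f ` fst E) (h ` fst F)"
      by (simp add: Plus_def image_Un image_image)
    moreover have "inj_on (map_sum f h) (Sum_Type.Plus (fst E) (fst F))"
    proof (rule inj_onI)
      have i: "inj_on f (fst E)" "inj_on h (fst F)" using f(1) h(1) by (simp_all add: bij_betw_def)
      fix x y assume "x \<in> Sum_Type.Plus (fst E) (fst F)" "y \<in> Sum_Type.Plus (fst E) (fst F)" "map_sum f h x = map_sum f h y"
      then show "x = y" by (elim PlusE) (simp_all add: inj_on_eq_iff[OF i(1)] inj_on_eq_iff[OF i(2)])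
    qed
    moreover have "f ` fst E = fst E'" "h ` fst F = fst F'" using f(1) h(1) by (simp_all add: bij_betw_def)
    ultimately show ?thesis unfolding bij_betw_def by (intro conjI) simp_all
  qed
  moreover have "map_sum f h (snd (gset_sum E F) g x) = snd (gset_sum E' F') g (map_sum f h x)"
    if g: "g \<in> carrier G" and x: "x \<in> Sum_Type.Plus (fst E) (fst F)" for g x
    using x
  proof (cases x)
    case (Inl e)
    with x have "e \<in> fst E" by (simp add: Plus_def image_iff)
    moreover from this have "f e \<in> fst E'" using f(1) by (auto simp: bij_betw_def)
    ultimately show ?thesis using Inl f(2) g by (simp add: gset_sum_def InlI)
  next
    case (Inr e)
    with x have "e \<in> fst F" by (simp add: Plus_def image_iff)
    moreover from this have "h e \<in> fst F'" using h(1) by (auto simp: bij_betw_def)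
    ultimately show ?thesis using Inr h(2) g by (simp add: gset_sum_def InrI)
  qed
  ultimately show ?thesis
    unfolding gset_iso_def by (intro exI[of _ "map_sum f h"]) (simp add: gset_sum_def)
qed

lemma gclass_mult:
  assumes E: "finite_gset G E" and F: "finite_gset G F"
  shows "gset_class G E \<otimes>\<^bsub>gclass_monoid G\<^esub> gset_class G F = gset_class G (gset_prod E F)"
proof -
  have "gset_class G (gset_prod E' F') = gset_class G (gset_prod E F)" 
    if "E' \<in> gset_class G E" "F' \<in> gset_class G F" for E' F'
    using that unfolding gset_class_def[of G E] gset_class_def[of G F]
    by (intro gset_class_eq finite_gset_prod gset_prod_iso) (auto intro: E F gset_iso_sym)
  then have "gset_class G E \<otimes>\<^bsub>gclass_monoid G\<^esub> gset_class G F = (\<Union>E'\<in>gset_class G E. \<Union>F'\<in>gset_class G F. gset_class G (gset_prod E F))"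
    unfolding gclass_monoid_def by (simp cong: SUP_cong)
  moreover obtain E0 F0 where "E0 \<in> gset_class G E" "F0 \<in> gset_class G F"
    using gset_class_nonempty[OF E] gset_class_nonempty[OF F] by metis
  then have "gset_class G E \<noteq> {}" "gset_class G F \<noteq> {}" by auto
  ultimately show ?thesis by simp
qed

lemma gclass_one: "\<one>\<^bsub>gclass_monoid G\<^esub> = gset_class G gset_point"
  by (simp add: gclass_monoid_def)

lemma gclass_cases:
  assumes "C \<in> carrier (gclass_monoid G)"
  obtains E :: "('g, nat) gset" where "finite_gset (G :: ('g, 'm) monoid_scheme) E" "C = gset_class G E"
  using assms by (auto simp: gclass_monoid_def)

lemma gclass_comm_monoid:
  assumes G: "Group.group G"
  shows "Group.comm_monoid (gclass_monoid G)"
proof (rule comm_monoidI)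
  note fp = finite_gset_point[OF G]
  show "\<one>\<^bsub>gclass_monoid G\<^esub> \<in> carrier (gclass_monoid G)"
    using fp by (simp add: gclass_one gset_class_in)
  fix A assume "A \<in> carrier (gclass_monoid G)"
  then obtain E :: "('a, nat) gset" where E: "finite_gset G E" "A = gset_class G E" by (rule gclass_cases)
  have "gset_iso G (gset_prod gset_point E) E"
    unfolding gset_iso_def gset_prod_def gset_point_def
    by (rule exI[of _ snd]) (auto simp: bij_betw_def inj_on_def)
  then show "\<one>\<^bsub>gclass_monoid G\<^esub> \<otimes>\<^bsub>gclass_monoid G\<^esub> A = A"
    using E fp by (simp add: gclass_one gclass_mult gset_class_eq finite_gset_prod)
  fix B assume "B \<in> carrier (gclass_monoid G)"
  then obtain F :: "('a, nat) gset" where F: "finite_gset G F" "B = gset_class G F" by (rule gclass_cases)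
  show "A \<otimes>\<^bsub>gclass_monoid G\<^esub> B \<in> carrier (gclass_monoid G)"
    using E F by (simp add: gclass_mult gset_class_in finite_gset_prod)
  have "gset_iso G (gset_prod E F) (gset_prod F E)"
    unfolding gset_iso_def gset_prod_def
    by (rule exI[of _ prod.swap]) (auto simp: bij_betw_def inj_on_def gset_closed[OF E(1)] gset_closed[OF F(1)])
  then show "A \<otimes>\<^bsub>gclass_monoid G\<^esub> B = B \<otimes>\<^bsub>gclass_monoid G\<^esub> A"
    using E F by (simp add: gclass_mult finite_gset_prod gset_class_eq)
  fix C assume "C \<in> carrier (gclass_monoid G)"
  then obtain H :: "('a, nat) gset" where H: "finite_gset G H" "C = gset_class G H" by (rule gclass_cases)
  have "gset_iso G (gset_prod (gset_prod E F) H) (gset_prod E (gset_prod F H))"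
    unfolding gset_iso_def gset_prod_def
    by (rule exI[of _ "\<lambda>((a,b),c). (a,(b,c))"])
       (auto simp: bij_betw_def inj_on_def image_iff gset_closed[OF E(1)] gset_closed[OF F(1)] gset_closed[OF H(1)])
  then show "A \<otimes>\<^bsub>gclass_monoid G\<^esub> B \<otimes>\<^bsub>gclass_monoid G\<^esub> C = A \<otimes>\<^bsub>gclass_monoid G\<^esub> (B \<otimes>\<^bsub>gclass_monoid G\<^esub> C)"
    using E F H by (simp add: gclass_mult finite_gset_prod gset_class_eq)
qed

lemma burnside_relationI:
  assumes E: "finite_gset G E" and F: "finite_gset G F"
  shows "(gset_class G (gset_sum E F), gset_class G E, gset_class G F) \<in> burnside_relations G"
proof -
  obtain E' :: "('a, nat) gset" where E': "finite_gset G E'" "gset_iso G E E'" "gset_class G E = gset_class G E'"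
    using gset_class_nat_rep[OF E] .
  obtain F' :: "('a, nat) gset" where F': "finite_gset G F'" "gset_iso G F F'" "gset_class G F = gset_class G F'"
    using gset_class_nat_rep[OF F] .
  have "gset_class G (gset_sum E F) = gset_class G (gset_sum E' F')"
    using E F E' F' by (intro gset_class_eq finite_gset_sum gset_sum_iso)
  then show ?thesis unfolding burnside_relations_def mem_Collect_eq
    using E' F' by (intro exI[of _ E'] exI[of _ F']) simp
qed

lemma burnside_presentation:
  assumes G: "Group.group G"
  shows "presentation (gclass_monoid G) (burnside_relations G)"
proof (intro presentation.intro presentation_axioms.intro gclass_comm_monoid[OF G])
  fix a b c assume t: "(a, b, c) \<in> burnside_relations G"
  then obtain E F :: "('a, nat) gset" where E: "finite_gset G E" and F: "finite_gset G F"
    and abc: "a = gset_class G (gset_sum E F)" "b = gset_class G E" "c = gset_class G F"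
    by (auto simp: burnside_relations_def)
  then show "a \<in> carrier (gclass_monoid G) \<and> b \<in> carrier (gclass_monoid G) \<and> c \<in> carrier (gclass_monoid G)"
    by (simp add: gset_class_in finite_gset_sum)
  fix s assume "s \<in> carrier (gclass_monoid G)"
  then obtain H :: "('a, nat) gset" where H: "finite_gset G H" "s = gset_class G H" by (rule gclass_cases)
  have "gset_iso G (gset_prod H (gset_sum E F)) (gset_sum (gset_prod H E) (gset_prod H F))"
    unfolding gset_iso_def
  proof (intro exI conjI)
    let ?f = "\<lambda>(h, x). case x of Inl e \<Rightarrow> Inl (h, e) | Inr f \<Rightarrow> Inr (h, f)"
    show "bij_betw ?f (fst (gset_prod H (gset_sum E F))) (fst (gset_sum (gset_prod H E) (gset_prod H F)))"
      by (rule bij_betw_byWitness[where f' = "\<lambda>s. case s of Inl (h, e) \<Rightarrow> (h, Inl e) | Inr (h, f) \<Rightarrow> (h, Inr f)"])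
         (auto simp: gset_prod_def gset_sum_def)
    show "\<forall>g\<in>carrier G. \<forall>x\<in>fst (gset_prod H (gset_sum E F)).
        ?f (snd (gset_prod H (gset_sum E F)) g x) = snd (gset_sum (gset_prod H E) (gset_prod H F)) g (?f x)"
      by (auto simp: gset_prod_def gset_sum_def gset_closed[OF H(1)] gset_closed[OF E(1)] gset_closed[OF F(1)])
  qed
  then have "gset_class G (gset_prod H (gset_sum E F)) = gset_class G (gset_sum (gset_prod H E) (gset_prod H F))"
    using E F H by (intro gset_class_eq finite_gset_prod finite_gset_sum) auto
  then show "(s \<otimes>\<^bsub>gclass_monoid G\<^esub> a, s \<otimes>\<^bsub>gclass_monoid G\<^esub> b, s \<otimes>\<^bsub>gclass_monoid G\<^esub> c) \<in> burnside_relations G"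
    using E F H burnside_relationI[of G "gset_prod H E" "gset_prod H F"] 
    by (simp add: abc gclass_mult finite_gset_prod finite_gset_sum)
qed


section \<open>The rational Burnside algebra and the cardinality map\<close>

lemma rat_ring_simps:
  "carrier rat_ring = UNIV" "x \<otimes>\<^bsub>rat_ring\<^esub> y = x * y" "\<one>\<^bsub>rat_ring\<^esub> = 1" "\<zero>\<^bsub>rat_ring\<^esub> = 0" "x \<oplus>\<^bsub>rat_ring\<^esub> y = x + y"
  by (simp_all add: ring_of_type_algebra_def)

lemma rat_self_simps:
  "carrier rat_self_algebra = UNIV" "x \<otimes>\<^bsub>rat_self_algebra\<^esub> y = x * y" "\<one>\<^bsub>rat_self_algebra\<^esub> = 1" "\<zero>\<^bsub>rat_self_algebra\<^esub> = 0" "x \<oplus>\<^bsub>rat_self_algebra\<^esub> y = x + y"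
  "q \<odot>\<^bsub>rat_self_algebra\<^esub> x = q * x"
  by (simp_all add: rat_self_algebra_def ring.extend_def ring_of_type_algebra_def)

lemma rat_self_abelian: "abelian_group rat_self_algebra"
  by (rule abelian_groupI) (auto simp: rat_self_simps intro: exI[of _ "- _"])

lemma rat_tensor_simps:
  fixes A :: "('a, 'm) ring_scheme"
  defines "T \<equiv> presented_ring (rat_ring \<times>\<times> A) (tensor_relations A)"
  shows "carrier (rat_tensor A) = carrier T" "x \<otimes>\<^bsub>rat_tensor A\<^esub> y = x \<otimes>\<^bsub>T\<^esub> y" "\<one>\<^bsub>rat_tensor A\<^esub> = \<one>\<^bsub>T\<^esub>"
    "\<zero>\<^bsub>rat_tensor A\<^esub> = \<zero>\<^bsub>T\<^esub>" "x \<oplus>\<^bsub>rat_tensor A\<^esub> y = x \<oplus>\<^bsub>T\<^esub> y"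
    "q \<odot>\<^bsub>rat_tensor A\<^esub> x = pure_tensor A q \<one>\<^bsub>A\<^esub> \<otimes>\<^bsub>T\<^esub> x"
  by (simp_all add: rat_tensor_def T_def Let_def ring.extend_def)

context cring begin

lemma tensor_presentation: "presentation (rat_ring \<times>\<times> R) (tensor_relations R)"
proof (intro presentation.intro presentation_axioms.intro)
  show "Group.comm_monoid (rat_ring \<times>\<times> R)"
    by (rule comm_monoidI) (auto simp: rat_ring_simps m_assoc m_comm m_lcomm)
qed (auto simp: tensor_relations_def rat_ring_simps r_distr distrib_left)

interpretation T: presentation "rat_ring \<times>\<times> R" "tensor_relations R"
  by (rule tensor_presentation)

lemma pt_closed [simp]: "a \<in> carrier R \<Longrightarrow> pure_tensor R q a \<in> carrier T.P"
  unfolding pure_tensor_def by (rule T.gen_closed) (simp add: rat_ring_simps)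

lemma pt_mult: "a \<in> carrier R \<Longrightarrow> b \<in> carrier R \<Longrightarrow> pure_tensor R p a \<otimes>\<^bsub>T.P\<^esub> pure_tensor R q b = pure_tensor R (p * q) (a \<otimes> b)"
  unfolding pure_tensor_def by (subst T.gen_mult) (auto simp: rat_ring_simps)

lemma pt_one: "pure_tensor R 1 \<one> = \<one>\<^bsub>T.P\<^esub>"
  using T.gen_one by (simp add: pure_tensor_def rat_ring_simps)

lemma pt_addl: "a \<in> carrier R \<Longrightarrow> pure_tensor R (p + q) a = pure_tensor R p a \<oplus>\<^bsub>T.P\<^esub> pure_tensor R q a"
  unfolding pure_tensor_def by (rule T.gen_rel) (auto simp: tensor_relations_def)

lemma pt_addr: "a \<in> carrier R \<Longrightarrow> b \<in> carrier R \<Longrightarrow> pure_tensor R q (a \<oplus> b) = pure_tensor R q a \<oplus>\<^bsub>T.P\<^esub> pure_tensor R q b"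
  unfolding pure_tensor_def by (rule T.gen_rel) (auto simp: tensor_relations_def)

lemma pt_smult: "a \<in> carrier R \<Longrightarrow> p \<odot>\<^bsub>rat_tensor R\<^esub> pure_tensor R q a = pure_tensor R (p * q) a"
  by (simp add: rat_tensor_simps pt_mult)

lemma rat_tensor_algebra: "algebra rat_ring (rat_tensor R)"
proof (rule algebraI)
  show "cring rat_ring" by (rule cring_from_type_algebra)
  show "cring (rat_tensor R)"
    by (intro cringI abelian_groupI comm_monoidI) 
       (auto simp: rat_tensor_simps T.P.m_assoc T.P.m_comm T.P.l_distr T.P.a_assoc T.P.a_comm T.P.m_lcomm T.P.a_lcomm T.P.r_distr intro: T.P.l_neg T.P.a_inv_closed)
qed (simp_all add: rat_ring_simps(1,2,3,5) rat_tensor_simps pt_one pt_addl T.P.l_distr T.P.r_distr T.P.m_assoc[symmetric] pt_mult)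

text \<open>Additive maps on the tensor product are determined on pure tensors.\<close>

lemma add_map_ext:
  assumes A: "abelian_group A"
    and f: "f \<in> carrier T.P \<rightarrow> carrier A" "\<And>x y. x \<in> carrier T.P \<Longrightarrow> y \<in> carrier T.P \<Longrightarrow> f (x \<oplus>\<^bsub>T.P\<^esub> y) = f x \<oplus>\<^bsub>A\<^esub> f y"
    and g: "g \<in> carrier T.P \<rightarrow> carrier A" "\<And>x y. x \<in> carrier T.P \<Longrightarrow> y \<in> carrier T.P \<Longrightarrow> g (x \<oplus>\<^bsub>T.P\<^esub> y) = g x \<oplus>\<^bsub>A\<^esub> g y"
    and eq: "\<And>q a. a \<in> carrier R \<Longrightarrow> f (pure_tensor R q a) = g (pure_tensor R q a)"
    and x: "x \<in> carrier T.P"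
  shows "f x = g x"
  by (rule T.additive_ext[OF A f g _ x]) (auto simp: eq simp flip: pure_tensor_def)

end


context
  fixes G :: "('g, 'm) monoid_scheme"
  assumes G: "Group.group G"
begin

interpretation P: presentation "gclass_monoid G" "burnside_relations G"
  by (rule burnside_presentation[OF G])

lemma burnside_cring: "cring (burnside_ring G)"
  unfolding burnside_ring_def by (rule P.P_cring)

interpretation B: cring "burnside_ring G" by (rule burnside_cring)

interpretation T: presentation "rat_ring \<times>\<times> burnside_ring G" "tensor_relations (burnside_ring G)"
  by (rule B.tensor_presentation)

lemma rat_burnside_algebra: "algebra rat_ring (rat_burnside_ring G)"
  unfolding rat_burnside_ring_def by (rule B.rat_tensor_algebra)

lemma burnside_class_closed: "finite_gset G E \<Longrightarrow> burnside_class G E \<in> carrier (burnside_ring G)"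
  unfolding burnside_class_def burnside_ring_def by (simp add: gset_class_in)

lemma rat_burnside_class_closed: "finite_gset G E \<Longrightarrow> rat_burnside_class G E \<in> carrier (rat_burnside_ring G)"
  unfolding rat_burnside_class_def rat_burnside_ring_def rat_tensor_simps
  by (simp add: burnside_class_closed)

lemma rat_burnside_class_eq:
  "finite_gset G E \<Longrightarrow> finite_gset G F \<Longrightarrow> gset_iso G E F \<Longrightarrow> rat_burnside_class G E = rat_burnside_class G F"
  by (simp add: rat_burnside_class_def burnside_class_def gset_class_eq)

lemma rat_burnside_class_sum:
  "finite_gset G E \<Longrightarrow> finite_gset G F \<Longrightarrow>
   rat_burnside_class G (gset_sum E F) = rat_burnside_class G E \<oplus>\<^bsub>rat_burnside_ring G\<^esub> rat_burnside_class G F"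
  using P.gen_rel[OF burnside_relationI, of E F] B.pt_addr[of "burnside_class G E" "burnside_class G F" 1]
    burnside_class_closed[of E] burnside_class_closed[of F]
  by (simp add: rat_burnside_class_def rat_burnside_ring_def rat_tensor_simps burnside_class_def burnside_ring_def)

lemma smult_class: 
  assumes "finite_gset G E"
  shows "q \<odot>\<^bsub>rat_burnside_ring G\<^esub> rat_burnside_class G E = pure_tensor (burnside_ring G) q (burnside_class G E)"
  unfolding rat_burnside_class_def rat_burnside_ring_def
  using B.pt_smult[OF burnside_class_closed[OF assms], of q 1] by simp

text \<open>A linear map on the rational Burnside ring is determined by its values on classes.\<close>

lemma linear_map_unique:
  assumes A: "abelian_group A"
    and f: "f \<in> linear_maps rat_ring (rat_burnside_ring G) A"
    and g: "g \<in> linear_maps rat_ring (rat_burnside_ring G) A"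
    and eq: "\<And>E :: ('g, nat) gset. finite_gset G E \<Longrightarrow> f (rat_burnside_class G E) = g (rat_burnside_class G E)"
    and x: "x \<in> carrier (rat_burnside_ring G)"
  shows "f x = g x"
proof -
  note simps = linear_maps_def rat_burnside_ring_def rat_tensor_simps(1,5)
  have F: "f \<in> carrier T.P \<rightarrow> carrier A" "\<And>x y. x \<in> carrier T.P \<Longrightarrow> y \<in> carrier T.P \<Longrightarrow> f (x \<oplus>\<^bsub>T.P\<^esub> y) = f x \<oplus>\<^bsub>A\<^esub> f y"
    using f by (simp_all add: simps)
  have H: "g \<in> carrier T.P \<rightarrow> carrier A" "\<And>x y. x \<in> carrier T.P \<Longrightarrow> y \<in> carrier T.P \<Longrightarrow> g (x \<oplus>\<^bsub>T.P\<^esub> y) = g x \<oplus>\<^bsub>A\<^esub> g y"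
    using g by (simp_all add: simps)
  have eq': "f (pure_tensor (burnside_ring G) q a) = g (pure_tensor (burnside_ring G) q a)"
    if a: "a \<in> carrier (burnside_ring G)" for q a
  proof -
    have a': "a \<in> carrier P.P" using a by (simp add: burnside_ring_def)
    show ?thesis
    proof (rule P.additive_ext[OF A _ _ _ _ _ a', where f = "\<lambda>a. f (pure_tensor (burnside_ring G) q a)" and g = "\<lambda>a. g (pure_tensor (burnside_ring G) q a)"])
      fix C assume "C \<in> carrier (gclass_monoid G)"
      then obtain E :: "('g, nat) gset" where E: "finite_gset G E" "C = gset_class G E" by (rule gclass_cases)
      have "pure_tensor (burnside_ring G) q (P.gen C) = q \<odot>\<^bsub>rat_burnside_ring G\<^esub> rat_burnside_class G E"
        using smult_class[OF E(1), of q] E by (simp add: burnside_class_def)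
      then show "f (pure_tensor (burnside_ring G) q (P.gen C)) = g (pure_tensor (burnside_ring G) q (P.gen C))"
        using eq[OF E(1)] f g rat_burnside_class_closed[OF E(1)] by (simp add: linear_maps_def rat_ring_simps)
    qed (use F H B.pt_closed B.pt_addr in \<open>auto simp: Pi_iff simp flip: burnside_ring_def\<close>)
  qed
  show ?thesis
    using x by (intro B.add_map_ext[OF A F H eq']) (simp_all add: rat_burnside_ring_def rat_tensor_simps(1))
qed

lemma burnside_additive_lift:
  assumes A: "abelian_group A"
    and f: "\<And>E :: ('g, nat) gset. finite_gset G E \<Longrightarrow> f E \<in> carrier A"
    and iso: "\<And>E F :: ('g, nat) gset. finite_gset G E \<Longrightarrow> finite_gset G F \<Longrightarrow> gset_iso G E F \<Longrightarrow> f E = f F"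
    and sum: "\<And>E F H :: ('g, nat) gset. finite_gset G E \<Longrightarrow> finite_gset G F \<Longrightarrow> finite_gset G H \<Longrightarrow>
       gset_iso G (gset_sum E F) H \<Longrightarrow> f H = f E \<oplus>\<^bsub>A\<^esub> f F"
  obtains h where "h \<in> carrier (burnside_ring G) \<rightarrow> carrier A"
    "\<And>x y. x \<in> carrier (burnside_ring G) \<Longrightarrow> y \<in> carrier (burnside_ring G) \<Longrightarrow> h (x \<oplus>\<^bsub>burnside_ring G\<^esub> y) = h x \<oplus>\<^bsub>A\<^esub> h y"
    "\<And>E :: ('g, nat) gset. finite_gset G E \<Longrightarrow> h (burnside_class G E) = f E"
proof -
  let ?f = "\<lambda>C. f (SOME E. finite_gset G E \<and> C = gset_class G E)"
  have v: "?f (gset_class G E) = f E" if E: "finite_gset G E" for E :: "('g, nat) gset"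
  proof -
    let ?F = "SOME F :: ('g, nat) gset. finite_gset G F \<and> gset_class G E = gset_class G F"
    have "finite_gset G ?F \<and> gset_class G E = gset_class G ?F"
      by (rule someI[of _ E]) (simp add: E)
    then show ?thesis using iso[OF E, of ?F] gset_class_eqD[OF E, of ?F] by simp
  qed
  have c: "?f C \<in> carrier A" if "C \<in> carrier (gclass_monoid G)" for C
    using that by (rule gclass_cases) (simp add: v f)
  have s: "?f a = ?f b \<oplus>\<^bsub>A\<^esub> ?f c" if abc: "(a, b, c) \<in> burnside_relations G" for a b c
  proof -
    obtain E F :: "('g, nat) gset" where E: "finite_gset G E" and F: "finite_gset G F"
      and abc: "a = gset_class G (gset_sum E F)" "b = gset_class G E" "c = gset_class G F"
      using abc unfolding burnside_relations_def by blast
    obtain H :: "('g, nat) gset" where H: "finite_gset G H" "gset_iso G (gset_sum E F) H" "a = gset_class G H"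
      using gset_class_nat_rep[OF finite_gset_sum[OF E F]] abc by metis
    show ?thesis using sum[OF E F H(1,2)] E F H(1) by (simp add: abc(2,3) H(3) v)
  qed
  obtain h where h: "h \<in> carrier P.P \<rightarrow> carrier A"
    "\<And>x y. x \<in> carrier P.P \<Longrightarrow> y \<in> carrier P.P \<Longrightarrow> h (x \<oplus>\<^bsub>P.P\<^esub> y) = h x \<oplus>\<^bsub>A\<^esub> h y"
    "\<And>s. s \<in> carrier (gclass_monoid G) \<Longrightarrow> h (P.gen s) = ?f s"
    using P.lift[where f = ?f, OF A c s] by blast
  show ?thesis
  proof (rule that[of h])
    show "h (burnside_class G E) = f E" if "finite_gset G E" for E :: "('g, nat) gset"
      using h(3)[OF gset_class_in[OF that]] v[OF that] by (simp add: burnside_class_def)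
  qed (use h in \<open>simp_all add: burnside_ring_def\<close>)
qed

lemma rat_linear_lift:
  assumes A: "abelian_group A"
    and f: "\<And>q a. a \<in> carrier (burnside_ring G) \<Longrightarrow> f q a \<in> carrier A"
    and l: "\<And>p q a. a \<in> carrier (burnside_ring G) \<Longrightarrow> f (p + q) a = f p a \<oplus>\<^bsub>A\<^esub> f q a"
    and r: "\<And>q a b. a \<in> carrier (burnside_ring G) \<Longrightarrow> b \<in> carrier (burnside_ring G) \<Longrightarrow> 
              f q (a \<oplus>\<^bsub>burnside_ring G\<^esub> b) = f q a \<oplus>\<^bsub>A\<^esub> f q b"
    and sm: "\<And>p q a. a \<in> carrier (burnside_ring G) \<Longrightarrow> f (p * q) a = p \<odot>\<^bsub>A\<^esub> f q a"
    and scl: "\<And>q x. x \<in> carrier A \<Longrightarrow> q \<odot>\<^bsub>A\<^esub> x \<in> carrier A"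
    and sadd: "\<And>q x y. x \<in> carrier A \<Longrightarrow> y \<in> carrier A \<Longrightarrow> q \<odot>\<^bsub>A\<^esub> (x \<oplus>\<^bsub>A\<^esub> y) = q \<odot>\<^bsub>A\<^esub> x \<oplus>\<^bsub>A\<^esub> q \<odot>\<^bsub>A\<^esub> y"
  obtains h where "h \<in> linear_maps rat_ring (rat_burnside_ring G) A" "h \<in> extensional (carrier (rat_burnside_ring G))"
    "\<And>q a. a \<in> carrier (burnside_ring G) \<Longrightarrow> h (pure_tensor (burnside_ring G) q a) = f q a"
proof -
  interpret Q: algebra rat_ring "rat_burnside_ring G" by (rule rat_burnside_algebra)
  have QT: "carrier (rat_burnside_ring G) = carrier T.P" "\<And>x y. x \<oplus>\<^bsub>rat_burnside_ring G\<^esub> y = x \<oplus>\<^bsub>T.P\<^esub> y"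
    by (simp_all add: rat_burnside_ring_def rat_tensor_simps)
  let ?f = "\<lambda>(q, a). f q a"
  have c: "?f s \<in> carrier A" if "s \<in> carrier (rat_ring \<times>\<times> burnside_ring G)" for s
    using that f by auto
  have s: "?f a = ?f b \<oplus>\<^bsub>A\<^esub> ?f c" if "(a, b, c) \<in> tensor_relations (burnside_ring G)" for a b c
    using that l r by (auto simp: tensor_relations_def)
  obtain h where h: "h \<in> carrier T.P \<rightarrow> carrier A"
    "\<And>x y. x \<in> carrier T.P \<Longrightarrow> y \<in> carrier T.P \<Longrightarrow> h (x \<oplus>\<^bsub>T.P\<^esub> y) = h x \<oplus>\<^bsub>A\<^esub> h y"
    "\<And>s. s \<in> carrier (rat_ring \<times>\<times> burnside_ring G) \<Longrightarrow> h (T.gen s) = ?f s"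
    using T.lift[where f = ?f, OF A c s] by blast
  have ht: "h (pure_tensor (burnside_ring G) q a) = f q a" if "a \<in> carrier (burnside_ring G)" for q a
    using h(3)[of "(q, a)"] that by (simp add: pure_tensor_def rat_ring_simps)
  have sm': "h (p \<odot>\<^bsub>rat_burnside_ring G\<^esub> x) = p \<odot>\<^bsub>A\<^esub> h x" if x: "x \<in> carrier T.P" for p x
  proof (rule B.add_map_ext[OF A _ _ _ _ _ x, where f = "\<lambda>x. h (p \<odot>\<^bsub>rat_burnside_ring G\<^esub> x)" and g = "\<lambda>x. p \<odot>\<^bsub>A\<^esub> h x"])
    have cl: "p \<odot>\<^bsub>rat_burnside_ring G\<^esub> x \<in> carrier T.P" if "x \<in> carrier T.P" for x
      using Q.smult_closed[of p x] that by (simp add: QT rat_ring_simps)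
    then show "(\<lambda>x. h (p \<odot>\<^bsub>rat_burnside_ring G\<^esub> x)) \<in> carrier T.P \<rightarrow> carrier A" 
      using h(1) by auto
    show "h (p \<odot>\<^bsub>rat_burnside_ring G\<^esub> (x \<oplus>\<^bsub>T.P\<^esub> y)) = h (p \<odot>\<^bsub>rat_burnside_ring G\<^esub> x) \<oplus>\<^bsub>A\<^esub> h (p \<odot>\<^bsub>rat_burnside_ring G\<^esub> y)"
      if "x \<in> carrier T.P" "y \<in> carrier T.P" for x y
      using Q.smult_r_distr[of p x y] h(2)[OF cl cl] that by (simp add: QT rat_ring_simps)
    show "(\<lambda>x. p \<odot>\<^bsub>A\<^esub> h x) \<in> carrier T.P \<rightarrow> carrier A" using h(1) scl by auto
    show "p \<odot>\<^bsub>A\<^esub> h (x \<oplus>\<^bsub>T.P\<^esub> y) = p \<odot>\<^bsub>A\<^esub> h x \<oplus>\<^bsub>A\<^esub> p \<odot>\<^bsub>A\<^esub> h y"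
      if "x \<in> carrier T.P" "y \<in> carrier T.P" for x y
      using that h(1) by (simp add: h(2) sadd Pi_iff)
    show "h (p \<odot>\<^bsub>rat_burnside_ring G\<^esub> pure_tensor (burnside_ring G) q a) = p \<odot>\<^bsub>A\<^esub> h (pure_tensor (burnside_ring G) q a)"
      if "a \<in> carrier (burnside_ring G)" for q a
      using that by (simp add: rat_burnside_ring_def B.pt_smult ht sm)
  qed
  show ?thesis
  proof (rule that[of "restrict h (carrier T.P)"])
    show "restrict h (carrier T.P) \<in> linear_maps rat_ring (rat_burnside_ring G) A"
      using h(1,2) sm' Q.smult_closed by (auto simp: linear_maps_def QT rat_ring_simps)
    show "restrict h (carrier T.P) (pure_tensor (burnside_ring G) q a) = f q a"
      if "a \<in> carrier (burnside_ring G)" for q a using that by (simp add: ht)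
  qed (simp add: QT)
qed

lemma burnside_card_ex1:
  "\<exists>!c. c \<in> extensional (carrier (rat_burnside_ring G)) \<and>
        c \<in> ring_hom (rat_burnside_ring G) rat_self_algebra \<and>
        c \<in> linear_maps rat_ring (rat_burnside_ring G) rat_self_algebra \<and>
        (\<forall>E :: ('g, nat) gset. finite_gset G E \<longrightarrow> c (rat_burnside_class G E) = of_nat (card (fst E)))"
proof -
  have qc: "cring rat_self_algebra"
    by (intro cringI rat_self_abelian comm_monoidI) (auto simp: rat_self_simps algebra_simps)
  obtain c0 where c0: "c0 \<in> carrier (burnside_ring G) \<rightarrow> carrier rat_self_algebra"
    "\<And>x y. x \<in> carrier (burnside_ring G) \<Longrightarrow> y \<in> carrier (burnside_ring G) \<Longrightarrow> 
      c0 (x \<oplus>\<^bsub>burnside_ring G\<^esub> y) = c0 x \<oplus>\<^bsub>rat_self_algebra\<^esub> c0 y"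
    "\<And>E :: ('g, nat) gset. finite_gset G E \<Longrightarrow> c0 (burnside_class G E) = of_nat (card (fst E))"
  proof (rule burnside_additive_lift[OF rat_self_abelian, where f = "\<lambda>E. of_nat (card (fst E))"])
    fix E F H :: "('g, nat) gset"
    assume "finite_gset G E" "finite_gset G F" "gset_iso G (gset_sum E F) H"
    then show "(of_nat (card (fst H)) :: rat) = of_nat (card (fst E)) \<oplus>\<^bsub>rat_self_algebra\<^esub> of_nat (card (fst F))"
      using gset_iso_card[of G "gset_sum E F" H] gset_finite[of G E] gset_finite[of G F] 
      by (simp add: rat_self_simps gset_sum_def card_Plus)
  qed (use gset_iso_card in \<open>auto simp: rat_self_simps\<close>)
  have c0h: "c0 \<in> ring_hom (burnside_ring G) rat_self_algebra"
    unfolding burnside_ring_def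
  proof (rule P.lift_mult[OF qc])
    show "c0 \<in> carrier P.P \<rightarrow> carrier rat_self_algebra" using c0(1) by (simp add: burnside_ring_def)
    show "c0 (x \<oplus>\<^bsub>P.P\<^esub> y) = c0 x \<oplus>\<^bsub>rat_self_algebra\<^esub> c0 y" if "x \<in> carrier P.P" "y \<in> carrier P.P" for x y
      using c0(2) that by (simp add: burnside_ring_def)
    have c03: "c0 (P.gen (gset_class G E)) = of_nat (card (fst E))" if E: "finite_gset G E" for E :: "('g, 'z) gset"
      using c0(3) gset_class_nat_rep[OF E] gset_iso_card unfolding burnside_class_def by metis
    show "c0 (P.gen \<one>\<^bsub>gclass_monoid G\<^esub>) = \<one>\<^bsub>rat_self_algebra\<^esub>"
    proof -
      obtain F :: "('g, nat) gset" where F: "finite_gset G F" "gset_iso G gset_point F" "gset_class G gset_point = gset_class G F"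
        using gset_class_nat_rep[OF finite_gset_point[OF G]] .
      then show ?thesis using c03[OF F(1)] gset_iso_card[OF F(2)]
        by (simp add: gclass_one rat_self_simps) (simp add: gset_point_def)
    qed
    fix s t assume "s \<in> carrier (gclass_monoid G)" "t \<in> carrier (gclass_monoid G)"
    then obtain E F :: "('g, nat) gset" where E: "finite_gset G E" "s = gset_class G E" and F: "finite_gset G F" "t = gset_class G F"
      by (metis gclass_cases)
    obtain H :: "('g, nat) gset" where H: "finite_gset G H" "gset_iso G (gset_prod E F) H" "gset_class G (gset_prod E F) = gset_class G H"
      using gset_class_nat_rep[OF finite_gset_prod[OF E(1) F(1)]] .
    have "card (fst H) = card (fst E) * card (fst F)"
      using gset_iso_card[OF H(2)] by (simp add: gset_prod_def card_cartesian_product)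
    then show "c0 (P.gen (s \<otimes>\<^bsub>gclass_monoid G\<^esub> t)) = c0 (P.gen s) \<otimes>\<^bsub>rat_self_algebra\<^esub> c0 (P.gen t)"
      using c03[OF H(1)] c03[OF E(1)] c03[OF F(1)] E F H(3)
      by (simp add: gclass_mult rat_self_simps)
  qed
  obtain c where c: "c \<in> linear_maps rat_ring (rat_burnside_ring G) rat_self_algebra" "c \<in> extensional (carrier (rat_burnside_ring G))"
    "\<And>q a. a \<in> carrier (burnside_ring G) \<Longrightarrow> c (pure_tensor (burnside_ring G) q a) = q * c0 a"
    using rat_linear_lift[OF rat_self_abelian, where f = "\<lambda>q a. q * c0 a"] c0 
    by (auto simp: rat_self_simps algebra_simps)
  have "c \<in> ring_hom T.P rat_self_algebra"
  proof (rule T.lift_mult[OF qc])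
    show "c \<in> carrier T.P \<rightarrow> carrier rat_self_algebra" by (simp add: rat_self_simps)
    show "c (x \<oplus>\<^bsub>T.P\<^esub> y) = c x \<oplus>\<^bsub>rat_self_algebra\<^esub> c y" if "x \<in> carrier T.P" "y \<in> carrier T.P" for x y
      using c(1) that by (simp add: linear_maps_def rat_burnside_ring_def rat_tensor_simps)
  qed (use ring_hom_mult[OF c0h] ring_hom_one[OF c0h] in \<open>auto simp: c(3) rat_self_simps rat_ring_simps simp flip: pure_tensor_def\<close>)
  then have ch: "c \<in> ring_hom (rat_burnside_ring G) rat_self_algebra"
    by (simp add: ring_hom_def rat_burnside_ring_def rat_tensor_simps)
  show ?thesis
  proof (rule ex1I[of _ c])
    show cc: "c \<in> extensional (carrier (rat_burnside_ring G)) \<and>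
        c \<in> ring_hom (rat_burnside_ring G) rat_self_algebra \<and>
        c \<in> linear_maps rat_ring (rat_burnside_ring G) rat_self_algebra \<and>
        (\<forall>E :: ('g, nat) gset. finite_gset G E \<longrightarrow> c (rat_burnside_class G E) = of_nat (card (fst E)))"
      using c ch by (simp add: rat_burnside_class_def burnside_class_closed c0(3))
    fix d assume d: "d \<in> extensional (carrier (rat_burnside_ring G)) \<and>
        d \<in> ring_hom (rat_burnside_ring G) rat_self_algebra \<and>
        d \<in> linear_maps rat_ring (rat_burnside_ring G) rat_self_algebra \<and>
        (\<forall>E :: ('g, nat) gset. finite_gset G E \<longrightarrow> d (rat_burnside_class G E) = of_nat (card (fst E)))"
    show "d = c"
      by (rule extensionalityI[of _ "carrier (rat_burnside_ring G)"])
         (use cc d linear_map_unique[OF rat_self_abelian, of d c] in auto)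
  qed
qed

end

lemma burnside_card_props:
  fixes G :: "('g, 'm) monoid_scheme"
  assumes "Group.group G"
  shows "burnside_card G \<in> extensional (carrier (rat_burnside_ring G))"
    and "burnside_card G \<in> ring_hom (rat_burnside_ring G) rat_self_algebra"
    and "burnside_card G \<in> linear_maps rat_ring (rat_burnside_ring G) rat_self_algebra"
    and "\<And>E :: ('g, nat) gset. finite_gset G E \<Longrightarrow> burnside_card G (rat_burnside_class G E) = of_nat (card (fst E))"
  using theI'[OF burnside_card_ex1[OF assms]] unfolding burnside_card_def by blast+


section \<open>Existence of deflation\<close>

context
  fixes G :: "('g, 'm) monoid_scheme" (structure) and N
  assumes normal: "N \<lhd> G"
begin

interpretation N: normal N G by (rule normal)

abbreviation "orb E x \<equiv> orbit (G\<lparr>carrier := N\<rparr>) (snd E) x"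

lemma orb_def: "orb E x = (\<lambda>n. snd E n x) ` N"
  by (auto simp: orbit_def)

lemma fst_orbit_gset: "fst (orbit_gset G N E) = orb E ` fst E"
  by (auto simp: orbit_gset_def orbits_def)

lemma orb_action:
  assumes E: "finite_gset G E" and g: "g \<in> carrier G" and x: "x \<in> fst E"
  shows "(\<Union>c\<in>N #> g. snd E c ` orb E x) = orb E (snd E g x)"
proof (intro subset_antisym subsetI)
  fix y assume "y \<in> (\<Union>c\<in>N #> g. snd E c ` orb E x)"
  then obtain n m where nm: "n \<in> N" "m \<in> N" "y = snd E (n \<otimes> g) (snd E m x)"
    by (auto simp: r_coset_def orb_def)
  have c: "n \<in> carrier G" "m \<in> carrier G" using nm N.subset by auto
  let ?k = "n \<otimes> (g \<otimes> m \<otimes> inv g)"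
  have k: "?k \<in> N" using nm(1,2) N.inv_op_closed2[OF g nm(2)] N.m_closed by simp
  have "y = snd E (n \<otimes> g \<otimes> m) x" using nm c g x by (simp add: gset_mult[OF E])
  also have "n \<otimes> g \<otimes> m = ?k \<otimes> g" using c g by (simp add: N.m_assoc)
  also have "snd E (?k \<otimes> g) x = snd E ?k (snd E g x)" using c g x by (subst gset_mult[OF E]) auto
  finally show "y \<in> orb E (snd E g x)" using k by (auto simp: orb_def)
next
  fix y assume "y \<in> orb E (snd E g x)"
  then obtain n where n: "n \<in> N" "y = snd E n (snd E g x)" by (auto simp: orb_def)
  then have "y = snd E (n \<otimes> g) (snd E \<one> x)" using N.subset g x by (auto simp: gset_mult[OF E] gset_one[OF E])
  then show "y \<in> (\<Union>c\<in>N #> g. snd E c ` orb E x)"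
    using n subgroup.one_closed[OF N.subgroup_axioms] unfolding r_coset_def orb_def by blast
qed

lemma snd_orbit_gset:
  assumes E: "finite_gset G E" and g: "g \<in> carrier G" and x: "x \<in> fst E"
  shows "snd (orbit_gset G N E) (N #> g) (orb E x) = orb E (snd E g x)"
  using x by (simp add: orbit_gset_def orb_action[OF assms]) (auto simp: orbits_def)

lemma finite_orbit_gset:
  assumes E: "finite_gset G E"
  shows "finite_gset (G Mod N) (orbit_gset G N E)"
proof -
  have "finite_gset (G Mod N) (fst (orbit_gset G N E), snd (orbit_gset G N E))"
  proof (rule finite_gsetI)
    show "Group.group (G Mod N)" by (rule N.factorgroup_is_group)
    show "finite (fst (orbit_gset G N E))" by (simp add: fst_orbit_gset gset_finite[OF E])
    show "snd (orbit_gset G N E) C \<in> extensional (fst (orbit_gset G N E))" for C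
      by (simp add: orbit_gset_def)
    fix C O' assume C: "C \<in> carrier (G Mod N)" and O': "O' \<in> fst (orbit_gset G N E)"
    then obtain g x where g: "g \<in> carrier G" "C = N #> g" and x: "x \<in> fst E" "O' = orb E x"
      by (auto simp: carrier_FactGroup fst_orbit_gset)
    then show "snd (orbit_gset G N E) C O' \<in> fst (orbit_gset G N E)"
      by (simp add: snd_orbit_gset[OF E]) (simp add: fst_orbit_gset gset_closed[OF E])
  next
    fix O' assume O': "O' \<in> fst (orbit_gset G N E)"
    then obtain x where x: "x \<in> fst E" "O' = orb E x" by (auto simp: fst_orbit_gset)
    then show "snd (orbit_gset G N E) \<one>\<^bsub>G Mod N\<^esub> O' = O'"
      using snd_orbit_gset[OF E N.one_closed x(1)] N.coset_mult_one[OF N.subset] by (simp add: gset_one[OF E])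
  next
    fix C D O' assume C: "C \<in> carrier (G Mod N)" and D: "D \<in> carrier (G Mod N)" and O': "O' \<in> fst (orbit_gset G N E)"
    then obtain g h x where g: "g \<in> carrier G" "C = N #> g" and h: "h \<in> carrier G" "D = N #> h" and x: "x \<in> fst E" "O' = orb E x"
      by (auto simp: carrier_FactGroup fst_orbit_gset)
    then show "snd (orbit_gset G N E) (C \<otimes>\<^bsub>G Mod N\<^esub> D) O' = snd (orbit_gset G N E) C (snd (orbit_gset G N E) D O')"
      by (simp add: N.rcos_sum snd_orbit_gset[OF E] gset_closed[OF E] gset_mult[OF E])
  qed
  then show ?thesis by simp
qed

lemma orbit_gset_iso:
  assumes E: "finite_gset G E" and F: "finite_gset G F" and i: "gset_iso G E F"
  shows "gset_iso (G Mod N) (orbit_gset G N E) (orbit_gset G N F)"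
proof -
  obtain f where f: "bij_betw f (fst E) (fst F)" "\<And>g x. g \<in> carrier G \<Longrightarrow> x \<in> fst E \<Longrightarrow> f (snd E g x) = snd F g (f x)"
    using i by (auto simp: gset_iso_def)
  have fo: "f ` orb E x = orb F (f x)" if "x \<in> fst E" for x
    unfolding orb_def image_image using f(2) that N.subset by (intro image_cong) auto
  have fx: "f x \<in> fst F" if "x \<in> fst E" for x using f(1) that by (rule bij_betw_apply)
  have sub: "orb E x \<subseteq> fst E" if "x \<in> fst E" for x
    using gset_closed[OF E _ that] N.subset by (auto simp: orb_def)
  have img: "f ` fst E = fst F" and inj: "inj_on f (fst E)" using f(1) by (simp_all add: bij_betw_def)
  have "bij_betw (image f) (fst (orbit_gset G N E)) (fst (orbit_gset G N F))"
    unfolding bij_betw_def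
  proof
    show "inj_on (image f) (fst (orbit_gset G N E))"
      by (rule inj_on_subset[OF inj_on_image_Pow[OF inj]]) (use sub in \<open>auto simp: fst_orbit_gset\<close>)
    show "image f ` fst (orbit_gset G N E) = fst (orbit_gset G N F)"
      unfolding fst_orbit_gset img[symmetric] image_image using fo by (intro image_cong) auto
  qed
  moreover have "f ` snd (orbit_gset G N E) C P = snd (orbit_gset G N F) C (f ` P)"
    if C: "C \<in> carrier (G Mod N)" and P: "P \<in> fst (orbit_gset G N E)" for C P
  proof -
    obtain g x where g: "g \<in> carrier G" "C = N #> g" and x: "x \<in> fst E" "P = orb E x"
      using C P by (auto simp: carrier_FactGroup fst_orbit_gset)
    then show ?thesis
      by (simp add: snd_orbit_gset[OF E] snd_orbit_gset[OF F] fo fx gset_closed[OF E] f(2))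
  qed
  ultimately show ?thesis unfolding gset_iso_def by blast
qed

lemma orbit_gset_sum:
  fixes E :: "('g, 'u) gset" and F :: "('g, 'v) gset"
  assumes E: "finite_gset G E" and F: "finite_gset G F"
  shows "gset_iso (G Mod N) (gset_sum (orbit_gset G N E) (orbit_gset G N F)) (orbit_gset G N (gset_sum E F))"
proof -
  let ?S = "gset_sum E F" and ?T = "gset_sum (orbit_gset G N E) (orbit_gset G N F)"
  note S = finite_gset_sum[OF E F]
  have ol: "orb ?S (Inl x) = Inl ` orb E x" if "x \<in> fst E" for x
    unfolding orb_def image_image using that by (intro image_cong) (auto simp: gset_sum_def InlI)
  have or: "orb ?S (Inr x) = Inr ` orb F x" if "x \<in> fst F" for x
    unfolding orb_def image_image using that by (intro image_cong) (auto simp: gset_sum_def InrI)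
  have fS: "fst ?S = Inl ` fst E \<union> Inr ` fst F" by (simp add: gset_sum_def Plus_def)
  have fT: "fst ?T = Inl ` (orb E ` fst E) \<union> Inr ` (orb F ` fst F)"
    by (simp add: gset_sum_def Plus_def flip: fst_orbit_gset)
  let ?f = "case_sum (image Inl) (image Inr)"
  have ne: "orb E x \<noteq> {}" "orb F y \<noteq> {}" for x y
    unfolding orb_def image_is_empty using N.subgroup_axioms subgroup.one_closed by blast+
  have "bij_betw ?f (fst ?T) (fst (orbit_gset G N ?S))"
    unfolding bij_betw_def
  proof
    show "inj_on ?f (fst ?T)"
    proof (rule inj_onI)
      fix a b assume a: "a \<in> fst ?T" and b: "b \<in> fst ?T" and eq: "?f a = ?f b"
      have inlr: "(Inl ` A :: ('u + 'v) set) \<noteq> Inr ` B" if ne': "A \<noteq> {}" for A :: "'u set" and B :: "'v set"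
      proof
        assume eq: "(Inl ` A :: ('u + 'v) set) = Inr ` B"
        obtain z where "z \<in> A" using ne' by blast
        then have "(Inl z :: 'u + 'v) \<in> Inr ` B" unfolding eq[symmetric] by blast
        then show False by blast
      qed
      show "a = b"
      proof (cases a; cases b)
        fix A B assume "a = Inl A" "b = Inl B" then show ?thesis using eq by (simp add: inj_image_eq_iff)
      next
        fix A B assume "a = Inr A" "b = Inr B" then show ?thesis using eq by (simp add: inj_image_eq_iff)
      next
        fix A B assume "a = Inl A" "b = Inr B" 
        then have "A \<in> orb E ` fst E" using a by (auto simp: fT)
        then have "A \<noteq> {}" using ne by (metis imageE)
        moreover have "Inl ` A = Inr ` B" using eq \<open>a = Inl A\<close> \<open>b = Inr B\<close> by simp
        ultimately show ?thesis using inlr by blast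
      next
        fix A B assume "a = Inr A" "b = Inl B" 
        then have "B \<in> orb E ` fst E" using b by (auto simp: fT)
        then have "B \<noteq> {}" using ne by (metis imageE)
        moreover have "Inl ` B = Inr ` A" using eq \<open>a = Inr A\<close> \<open>b = Inl B\<close> by simp
        ultimately show ?thesis using inlr by blast
      qed
    qed
    show "?f ` fst ?T = fst (orbit_gset G N ?S)"
      unfolding fst_orbit_gset fS fT image_Un image_image using ol or by (intro arg_cong2[of _ _ _ _ "(\<union>)"] image_cong) auto
  qed
  moreover have "?f (snd ?T C P) = snd (orbit_gset G N ?S) C (?f P)"
    if C: "C \<in> carrier (G Mod N)" and P: "P \<in> fst ?T" for C P
  proof -
    obtain g where g: "g \<in> carrier G" "C = N #> g" using C by (auto simp: carrier_FactGroup)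
    from P consider (l) x where "x \<in> fst E" "P = Inl (orb E x)" | (r) x where "x \<in> fst F" "P = Inr (orb F x)"
      unfolding fT by blast
    then show ?thesis
    proof cases
      case l
      have "snd ?T C P = Inl (snd (orbit_gset G N E) C (orb E x))"
        using P l by (simp add: gset_sum_def)
      moreover have "snd ?S g (Inl x) = Inl (snd E g x)" using l by (simp add: gset_sum_def InlI)
      moreover have "Inl x \<in> fst ?S" using l by (simp add: fS)
      ultimately show ?thesis
        using l g snd_orbit_gset[OF S g(1), of "Inl x"] by (simp add: snd_orbit_gset[OF E] ol gset_closed[OF E])
    next
      case r
      have "snd ?T C P = Inr (snd (orbit_gset G N F) C (orb F x))"
        using P r by (simp add: gset_sum_def)
      moreover have "snd ?S g (Inr x) = Inr (snd F g x)" using r by (simp add: gset_sum_def InrI)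
      moreover have "Inr x \<in> fst ?S" using r by (simp add: fS)
      ultimately show ?thesis
        using r g snd_orbit_gset[OF S g(1), of "Inr x"] by (simp add: snd_orbit_gset[OF F] or gset_closed[OF F])
    qed
  qed
  ultimately show ?thesis unfolding gset_iso_def by blast
qed

lemma deflation_ex1:
  "\<exists>!d. d \<in> extensional (carrier (rat_burnside_ring G)) \<and>
        d \<in> linear_maps rat_ring (rat_burnside_ring G) (rat_burnside_ring (G Mod N)) \<and>
        (\<forall>E :: ('g, nat) gset. finite_gset G E \<longrightarrow>
           d (rat_burnside_class G E) = rat_burnside_class (G Mod N) (orbit_gset G N E))"
proof -
  note G = N.is_group
  note H = N.factorgroup_is_group
  interpret B: cring "burnside_ring (G Mod N)" by (rule burnside_cring[OF H])
  interpret Q: algebra rat_ring "rat_burnside_ring (G Mod N)" by (rule rat_burnside_algebra[OF H])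
  obtain d0 where d0: "d0 \<in> carrier (burnside_ring G) \<rightarrow> carrier (burnside_ring (G Mod N))"
    "\<And>x y. x \<in> carrier (burnside_ring G) \<Longrightarrow> y \<in> carrier (burnside_ring G) \<Longrightarrow> 
      d0 (x \<oplus>\<^bsub>burnside_ring G\<^esub> y) = d0 x \<oplus>\<^bsub>burnside_ring (G Mod N)\<^esub> d0 y"
    "\<And>E :: ('g, nat) gset. finite_gset G E \<Longrightarrow> d0 (burnside_class G E) = burnside_class (G Mod N) (orbit_gset G N E)"
  proof (rule burnside_additive_lift[OF G B.abelian_group_axioms, where f = "\<lambda>E. burnside_class (G Mod N) (orbit_gset G N E)"])
    show "burnside_class (G Mod N) (orbit_gset G N E) \<in> carrier (burnside_ring (G Mod N))"
      if "finite_gset G E" for E :: "('g, nat) gset"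
      using burnside_class_closed[OF H finite_orbit_gset[OF that]] .
    show iso: "burnside_class (G Mod N) (orbit_gset G N E) = burnside_class (G Mod N) (orbit_gset G N F)"
      if "finite_gset G E" "finite_gset G F" "gset_iso G E F" for E F :: "('g, nat) gset"
      unfolding burnside_class_def
      using gset_class_eq[OF finite_orbit_gset[OF that(1)] finite_orbit_gset[OF that(2)] orbit_gset_iso[OF that]] by simp
    fix E F K :: "('g, nat) gset"
    assume E: "finite_gset G E" and F: "finite_gset G F" and K: "finite_gset G K" and i: "gset_iso G (gset_sum E F) K"
    note S = finite_gset_sum[OF E F]
    note oE = finite_orbit_gset[OF E] and oF = finite_orbit_gset[OF F]
    have "gset_class (G Mod N) (orbit_gset G N K) = gset_class (G Mod N) (orbit_gset G N (gset_sum E F))"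
      by (rule gset_class_eq[OF finite_orbit_gset[OF S] finite_orbit_gset[OF K] orbit_gset_iso[OF S K i], symmetric])
    also have "\<dots> = gset_class (G Mod N) (gset_sum (orbit_gset G N E) (orbit_gset G N F))"
      by (rule gset_class_eq[OF finite_gset_sum[OF oE oF] finite_orbit_gset[OF S] orbit_gset_sum[OF E F], symmetric])
    finally show "burnside_class (G Mod N) (orbit_gset G N K) =
       burnside_class (G Mod N) (orbit_gset G N E) \<oplus>\<^bsub>burnside_ring (G Mod N)\<^esub> burnside_class (G Mod N) (orbit_gset G N F)"
      using presentation.gen_rel[OF burnside_presentation[OF H] burnside_relationI[OF oE oF]]
      by (simp add: burnside_class_def burnside_ring_def)
  qed blast
  have QT: "carrier (rat_burnside_ring (G Mod N)) = carrier (rat_tensor (burnside_ring (G Mod N)))" by (simp add: rat_burnside_ring_def)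
  let ?B = "burnside_ring (G Mod N)"
  have dc: "d0 a \<in> carrier ?B" if "a \<in> carrier (burnside_ring G)" for a using d0(1) that by auto
  obtain d where d: "d \<in> linear_maps rat_ring (rat_burnside_ring G) (rat_burnside_ring (G Mod N))" "d \<in> extensional (carrier (rat_burnside_ring G))"
    "\<And>q a. a \<in> carrier (burnside_ring G) \<Longrightarrow> d (pure_tensor (burnside_ring G) q a) = pure_tensor ?B q (d0 a)"
  proof (rule rat_linear_lift[OF G Q.abelian_group_axioms, where f = "\<lambda>q a. pure_tensor ?B q (d0 a)"])
    show "pure_tensor ?B q (d0 a) \<in> carrier (rat_burnside_ring (G Mod N))" if "a \<in> carrier (burnside_ring G)" for q a
      unfolding rat_burnside_ring_def rat_tensor_simps using B.pt_closed dc[OF that] by simp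
    show "pure_tensor ?B (p + q) (d0 a) = pure_tensor ?B p (d0 a) \<oplus>\<^bsub>rat_burnside_ring (G Mod N)\<^esub> pure_tensor ?B q (d0 a)"
      if "a \<in> carrier (burnside_ring G)" for p q a
      unfolding rat_burnside_ring_def rat_tensor_simps using B.pt_addl dc[OF that] by simp
    show "pure_tensor ?B q (d0 (a \<oplus>\<^bsub>burnside_ring G\<^esub> b)) = pure_tensor ?B q (d0 a) \<oplus>\<^bsub>rat_burnside_ring (G Mod N)\<^esub> pure_tensor ?B q (d0 b)"
      if "a \<in> carrier (burnside_ring G)" "b \<in> carrier (burnside_ring G)" for q a b
      unfolding rat_burnside_ring_def rat_tensor_simps using B.pt_addr that by (simp add: dc d0(2))
    show "pure_tensor ?B (p * q) (d0 a) = p \<odot>\<^bsub>rat_burnside_ring (G Mod N)\<^esub> pure_tensor ?B q (d0 a)"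
      if "a \<in> carrier (burnside_ring G)" for p q a
      unfolding rat_burnside_ring_def using B.pt_smult dc[OF that] by simp
  qed (use Q.smult_closed Q.smult_r_distr in \<open>auto simp: rat_ring_simps\<close>)
  show ?thesis
  proof (rule ex1I[of _ d])
    show dd: "d \<in> extensional (carrier (rat_burnside_ring G)) \<and>
        d \<in> linear_maps rat_ring (rat_burnside_ring G) (rat_burnside_ring (G Mod N)) \<and>
        (\<forall>E :: ('g, nat) gset. finite_gset G E \<longrightarrow>
           d (rat_burnside_class G E) = rat_burnside_class (G Mod N) (orbit_gset G N E))"
      using d by (simp add: rat_burnside_class_def burnside_class_closed[OF G] d0(3))
    fix c assume c: "c \<in> extensional (carrier (rat_burnside_ring G)) \<and>
        c \<in> linear_maps rat_ring (rat_burnside_ring G) (rat_burnside_ring (G Mod N)) \<and>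
        (\<forall>E :: ('g, nat) gset. finite_gset G E \<longrightarrow>
           c (rat_burnside_class G E) = rat_burnside_class (G Mod N) (orbit_gset G N E))"
    show "c = d"
      by (rule extensionalityI[of _ "carrier (rat_burnside_ring G)"])
         (use c dd linear_map_unique[OF G Q.abelian_group_axioms, of c d] in auto)
  qed
qed

end

lemma deflation_props:
  fixes G :: "('g, 'm) monoid_scheme"
  assumes "N \<lhd> G"
  shows "deflation G N \<in> extensional (carrier (rat_burnside_ring G))"
    and "deflation G N \<in> linear_maps rat_ring (rat_burnside_ring G) (rat_burnside_ring (G Mod N))"
    and "\<And>E :: ('g, nat) gset. finite_gset G E \<Longrightarrow>
           deflation G N (rat_burnside_class G E) = rat_burnside_class (G Mod N) (orbit_gset G N E)"
  using theI'[OF deflation_ex1[OF assms]] unfolding deflation_def by blast+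

end

theory Submission
  imports Defs
begin

text \<open>The map \<^const>\<open>orbit_number\<close> is linear and takes the value 1 on every transitive class, so on
  \<open>e\<^sub>H\<close> it gives \<open>\<Sum>\<^bsub>K \<le> H\<^esub> |K| \<mu>(K, H) / |N(H)|\<close>.  Sorting the elements of K by the cyclic
  subgroup they generate and applying Moebius inversion, the numerator is the number of generators of H.
  The weight \<open>|G : H| / |N(H)|\<close> is \<open>1 / |H|\<close> times the size of the conjugacy class of H, so the sum
  over class representatives becomes the sum of \<open>1 / |H|\<close> over all pairs of a subgroup H and a
  generator of H, that is, of \<open>1 / o(g)\<close> over all g.\<close>

section \<open>Moebius inversion in a finite poset\<close>

text \<open>The recursion makes the value at \<open>y\<close> minus the sum over
  \<open>z < y\<close>, so adjoining the top term cancels everything unless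
  \<open>x = y\<close>.\<close>

lemma sum_poset_mobius:
  assumes "finite P" "x \<in> P" "y \<in> P" "x \<le> y"
  shows "(\<Sum>z\<in>{z\<in>P. x \<le> z \<and> z \<le> y}. poset_mobius P x z) = (if x = y then 1 else 0)"
proof -
  have "{z\<in>P. x \<le> z \<and> z \<le> y} = insert y {z\<in>P. x \<le> z \<and> z < y}"
    using assms by auto
  moreover have "y \<notin> {z\<in>P. x \<le> z \<and> z < y}" by simp
  moreover have "finite {z\<in>P. x \<le> z \<and> z < y}" using assms by simp
  ultimately have "(\<Sum>z\<in>{z\<in>P. x \<le> z \<and> z \<le> y}. poset_mobius P x z) =
      poset_mobius P x y + (\<Sum>z\<in>{z\<in>P. x \<le> z \<and> z < y}. poset_mobius P x z)"
    by simp
  also have "\<dots> = (if x = y then 1 else 0)"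
  proof (cases "x = y")
    case True
    then have "(\<Sum>z\<in>{z\<in>P. x \<le> z \<and> z < y}. poset_mobius P x z) = 0"
      by (intro sum.neutral) auto
    moreover have "poset_mobius P x x = 1"
      using assms by (subst poset_mobius.simps) simp
    ultimately show ?thesis using True by simp
  next
    case False
    with assms have "poset_mobius P x y = - (\<Sum>z\<in>{z\<in>P. x \<le> z \<and> z < y}. poset_mobius P x z)"
      by (subst poset_mobius.simps) simp
    with False show ?thesis by simp
  qed
  finally show ?thesis .
qed

text \<open>Summatory functions determine a function on a finite poset: by induction on the number
  of elements strictly below \<open>y\<close>, all terms except the one at \<open>y\<close> already
  agree.\<close>

lemma sum_below_unique:
  fixes f g :: "'a :: order \<Rightarrow> 'b :: ab_group_add"
  assumes fin: "finite P"
    and eq: "\<And>y. y \<in> P \<Longrightarrow> (\<Sum>z\<in>{z\<in>P. z \<le> y}. f z) = (\<Sum>z\<in>{z\<in>P. z \<le> y}. g z)"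
    and y: "y \<in> P"
  shows "f y = g y"
  using y
proof (induction "card {z\<in>P. z < y}" arbitrary: y rule: less_induct)
  case less
  have split: "{z\<in>P. z \<le> y} = insert y {z\<in>P. z < y}" using less.prems by auto
  have "f z = g z" if "z \<in> {z\<in>P. z < y}" for z
  proof (rule less.hyps)
    show "card {v\<in>P. v < z} < card {z\<in>P. z < y}"
      using that fin by (intro psubset_card_mono) auto
  qed (use that in simp)
  then have "(\<Sum>z\<in>{z\<in>P. z < y}. f z) = (\<Sum>z\<in>{z\<in>P. z < y}. g z)" by (rule sum.cong[OF refl])
  then show ?case using eq[OF less.prems] fin by (simp add: split)
qed

text \<open>\<^const>\<open>poset_mobius\<close> is defined by recursion on its second argument, so its sums over that argument are
  known.  Inversion uses the opposite convolution; comparing the summatory functions of both sides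
  avoids proving that the two convolution inverses agree.\<close>

lemma mobius_inversion:
  fixes f F :: "'a :: order \<Rightarrow> 'b :: comm_ring_1"
  assumes fin: "finite P"
    and F: "\<And>x. x \<in> P \<Longrightarrow> F x = (\<Sum>z\<in>{z\<in>P. z \<le> x}. f z)"
    and y: "y \<in> P"
  shows "(\<Sum>x\<in>{x\<in>P. x \<le> y}. F x * of_int (poset_mobius P x y)) = f y"
proof (rule sum_below_unique[OF fin _ y])
  fix y assume y: "y \<in> P"
  have "(\<Sum>z\<in>{z\<in>P. z \<le> y}. \<Sum>x\<in>{x\<in>P. x \<le> z}. F x * of_int (poset_mobius P x z)) =
      (\<Sum>x\<in>{x\<in>P. x \<le> y}. \<Sum>z\<in>{z\<in>P. x \<le> z \<and> z \<le> y}. F x * of_int (poset_mobius P x z))"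
  proof -
    \<comment> \<open>The bound \<open>x \<le> y\<close>, implied by
      \<open>x \<le> z \<le> y\<close>, is written out so that both indices range over fixed sets
      before the sums are interchanged.\<close>
    have "(\<Sum>z\<in>{z\<in>P. z \<le> y}. \<Sum>x\<in>{x\<in>P. x \<le> z}. F x * of_int (poset_mobius P x z)) =
        (\<Sum>z\<in>{z\<in>P. z \<le> y}. \<Sum>x\<in>{x \<in> {x\<in>P. x \<le> y}. x \<le> z}. F x * of_int (poset_mobius P x z))"
      by (intro sum.cong refl) auto
    also have "\<dots> = (\<Sum>x\<in>{x\<in>P. x \<le> y}. \<Sum>z\<in>{z \<in> {z\<in>P. z \<le> y}. x \<le> z}. F x * of_int (poset_mobius P x z))"
      using fin by (intro sum.swap_restrict) auto
    also have "\<dots> = (\<Sum>x\<in>{x\<in>P. x \<le> y}. \<Sum>z\<in>{z\<in>P. x \<le> z \<and> z \<le> y}. F x * of_int (poset_mobius P x z))"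
      by (intro sum.cong refl) auto
    finally show ?thesis .
  qed
  also have "\<dots> = (\<Sum>x\<in>{x\<in>P. x \<le> y}. if x = y then F x else 0)"
  proof (intro sum.cong refl)
    fix x assume "x \<in> {x\<in>P. x \<le> y}"
    then have "(\<Sum>z\<in>{z\<in>P. x \<le> z \<and> z \<le> y}. poset_mobius P x z) = (if x = y then 1 else 0)"
      using sum_poset_mobius[OF fin _ y] by simp
    then have "(of_int (\<Sum>z\<in>{z\<in>P. x \<le> z \<and> z \<le> y}. poset_mobius P x z) :: 'b) = (if x = y then 1 else 0)"
      by simp
    then show "(\<Sum>z\<in>{z\<in>P. x \<le> z \<and> z \<le> y}. F x * of_int (poset_mobius P x z)) = (if x = y then F x else 0)"
      by (simp flip: sum_distrib_left of_int_sum)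
  qed
  also have "\<dots> = F y"
    using fin y by simp
  finally show "(\<Sum>z\<in>{z\<in>P. z \<le> y}. \<Sum>x\<in>{x\<in>P. x \<le> z}. F x * of_int (poset_mobius P x z)) =
      (\<Sum>z\<in>{z\<in>P. z \<le> y}. f z)"
    using F[OF y] by simp
qed

section \<open>Coset spaces and the orbit count\<close>

lemma (in Group.group) finite_subgroups:
  assumes "finite (carrier G)" shows "finite {H. subgroup H G}"
  by (rule finite_subset[of _ "Pow (carrier G)"]) (use assms subgroup.subset in auto)

lemma (in Group.group) finite_gset_coset:
  assumes fin: "finite (carrier G)" and K: "subgroup K G"
  shows "finite_gset G (coset_gset G K)"
  unfolding coset_gset_def
proof (rule finite_gsetI)
  show "Group.group G" by (rule is_group)
  show "finite (lcosets K)" using fin by (simp add: LCOSETS_def)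
  fix g C assume g: "g \<in> carrier G" and C: "C \<in> lcosets K"
  then show "restrict (\<lambda>C. g <# C) (lcosets K) C \<in> lcosets K"
    using subgroup.subset[OF K] by (auto simp: LCOSETS_def lcos_m_assoc)
next
  fix C assume C: "C \<in> lcosets K"
  then show "restrict (\<lambda>C. \<one> <# C) (lcosets K) C = C"
    using subgroup.lcosets_carrier[OF K is_group C] by (simp add: lcos_mult_one)
next
  fix g h C assume g: "g \<in> carrier G" and h: "h \<in> carrier G" and C: "C \<in> lcosets K"
  then have "h <# C \<in> lcosets K"
    using subgroup.subset[OF K] by (auto simp: LCOSETS_def lcos_m_assoc)
  then show "restrict (\<lambda>C. (g \<otimes> h) <# C) (lcosets K) C =
      restrict (\<lambda>C. g <# C) (lcosets K) (restrict (\<lambda>C. h <# C) (lcosets K) C)"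
    using g h C subgroup.lcosets_carrier[OF K is_group C] by (simp add: lcos_m_assoc)
qed simp

lemma linear_map_sum:
  fixes M :: "(rat, 'a, 'm) module_scheme"
  assumes M: "module rat_ring M"
    and f: "f \<in> linear_maps rat_ring M rat_self_algebra"
    and fin: "finite A" and x: "\<And>i. i \<in> A \<Longrightarrow> x i \<in> carrier M"
  shows "f (finsum M x A) = (\<Sum>i\<in>A. f (x i))"
  using fin x
proof (induction A rule: finite_induct)
  case empty
  interpret module rat_ring M by (rule M)
  have "\<forall>x\<in>carrier M. \<forall>y\<in>carrier M. f (x \<oplus>\<^bsub>M\<^esub> y) = f x + f y"
    using f by (simp add: linear_maps_def rat_self_simps)
  \<comment> \<open>Preservation of zero is not a clause of \<open>linear_maps\<close>; it follows
    from \<open>f 0 = f 0 + f 0\<close>.\<close>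
  from this[rule_format, of "\<zero>\<^bsub>M\<^esub>" "\<zero>\<^bsub>M\<^esub>"] show ?case by simp
next
  case (insert i A)
  interpret module rat_ring M by (rule M)
  show ?case
    using insert f by (simp add: finsum_insert Pi_iff finsum_closed linear_maps_def rat_self_simps)
qed

text \<open>\<open>burnside_card\<close> is characterised on sets of naturals only. Coset spaces and
  orbit sets live on other types, so the value is carried over from an isomorphic copy.\<close>

lemma burnside_card_class:
  assumes E: "finite_gset L E"
  shows "burnside_card L (rat_burnside_class L E) = of_nat (card (fst E))"
proof -
  obtain F :: "('a, nat) gset" where F: "finite_gset L F" "gset_iso L E F"
    using gset_nat_copy[OF E] by blast
  have "burnside_card L (rat_burnside_class L F) = of_nat (card (fst F))"
    by (rule burnside_card_props(4)[OF gset_group[OF E] F(1)])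
  then show ?thesis
    using rat_burnside_class_eq[OF gset_group[OF E] E F] gset_iso_card[OF F(2)] by simp
qed

text \<open>As for cardinality, a copy on the naturals is used; an isomorphism of G-sets also
  induces one of the orbit sets over \<open>G Mod N\<close>, so both sides can be
  transported.\<close>

lemma deflation_class:
  assumes N: "N \<lhd> G" and E: "finite_gset G E"
  shows "deflation G N (rat_burnside_class G E) = rat_burnside_class (G Mod N) (orbit_gset G N E)"
proof -
  obtain F :: "('a, nat) gset" where F: "finite_gset G F" "gset_iso G E F"
    using gset_nat_copy[OF E] by blast
  have "deflation G N (rat_burnside_class G F) = rat_burnside_class (G Mod N) (orbit_gset G N F)"
    by (rule deflation_props(3)[OF N F(1)])
  then show ?thesis
    using rat_burnside_class_eq[OF gset_group[OF E] E F]
      rat_burnside_class_eq[OF normal.factorgroup_is_group[OF N] finite_orbit_gset[OF N E]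
        finite_orbit_gset[OF N F(1)] orbit_gset_iso[OF N E F]]
    by simp
qed

lemma (in Group.group) orbit_number_linear:
  "orbit_number G \<in> linear_maps rat_ring (rat_burnside_ring G) rat_self_algebra"
proof -
  have N: "carrier G \<lhd> G" by (rule normal_self)
  have "deflation G (carrier G) \<in> linear_maps rat_ring (rat_burnside_ring G) (rat_burnside_ring (G Mod carrier G))"
    by (rule deflation_props(2)[OF N])
  moreover have "burnside_card (G Mod carrier G) \<in>
      linear_maps rat_ring (rat_burnside_ring (G Mod carrier G)) rat_self_algebra"
    by (rule burnside_card_props(3)[OF normal.factorgroup_is_group[OF N]])
  ultimately show ?thesis
    by (auto simp: linear_maps_def orbit_number_def Pi_iff)
qed

text \<open>For \<open>N = carrier G\<close> the underlying set of the deflated set is by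
  construction the set of G-orbits.\<close>

lemma (in Group.group) orbit_number_class:
  assumes E: "finite_gset G E"
  shows "orbit_number G (rat_burnside_class G E) = of_nat (card (orbits G (fst E) (snd E)))"
  using burnside_card_class[OF finite_orbit_gset[OF normal_self E]]
  by (simp add: orbit_number_def deflation_class[OF normal_self E] orbit_gset_def)

lemma (in Group.group) orbits_coset_gset:
  assumes K: "subgroup K G"
  shows "orbits G (fst (coset_gset G K)) (snd (coset_gset G K)) = {lcosets K}"
proof -
  have "orbit G (snd (coset_gset G K)) C = lcosets K" if C: "C \<in> lcosets K" for C
  proof -
    obtain a where a: "a \<in> carrier G" "C = a <# K" using C by (auto simp: LCOSETS_def)
    have act: "snd (coset_gset G K) g C = (g \<otimes> a) <# K" if "g \<in> carrier G" for g
      using C a that subgroup.subset[OF K] by (simp add: coset_gset_def lcos_m_assoc)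
    have "b <# K \<in> orbit G (snd (coset_gset G K)) C" if b: "b \<in> carrier G" for b
    proof -
      \<comment> \<open>Transitivity: \<open>b \<otimes> inv a\<close> carries the coset of
        \<open>a\<close> to the coset of \<open>b\<close>.\<close>
      have "b <# K = snd (coset_gset G K) (b \<otimes> inv a) C"
        using a(1) b by (simp add: act m_assoc )
      then show ?thesis using a b unfolding orbit_def by blast
    qed
    then show ?thesis using a act by (auto simp: orbit_def LCOSETS_def)
  qed
  moreover have "lcosets K \<noteq> {}" using one_closed by (auto simp: LCOSETS_def)
  ultimately show ?thesis by (auto simp: orbits_def coset_gset_def)
qed

section \<open>Generators of cyclic subgroups\<close>

text \<open>The set is empty when \<open>H\<close> is not a cyclic subgroup, so sums may range over
  all subgroups.\<close>

definition (in Group.group) cyclic_generators :: "'a set \<Rightarrow> 'a set"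
  where "cyclic_generators H = {g \<in> carrier G. generate G {g} = H}"

text \<open>Each element of \<open>K\<close> generates exactly one subgroup, which lies in
  \<open>K\<close>, so the generator sets partition \<open>K\<close>. This exhibits
  \<open>card\<close> as the summatory function to be inverted.\<close>

lemma (in Group.group) sum_cyclic_generators:
  assumes fin: "finite (carrier G)" and K: "subgroup K G"
  shows "(\<Sum>H\<in>{H. subgroup H G \<and> H \<subseteq> K}. card (cyclic_generators H)) = card K"
proof -
  have "K = (\<Union>H\<in>{H. subgroup H G \<and> H \<subseteq> K}. cyclic_generators H)"
    using subgroup.subset[OF K] generate_subgroup_incl[OF _ K] generate.incl[of _ _ G]
    by (fastforce simp: cyclic_generators_def generate_is_subgroup)
  moreover have "card (\<Union>H\<in>{H. subgroup H G \<and> H \<subseteq> K}. cyclic_generators H) =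
      (\<Sum>H\<in>{H. subgroup H G \<and> H \<subseteq> K}. card (cyclic_generators H))"
    using fin finite_subgroups[OF fin] by (intro card_UN_disjoint) (auto simp: cyclic_generators_def)
  ultimately show ?thesis by metis
qed

text \<open>Inversion of the preceding count in the poset of subgroups under inclusion.\<close>

lemma (in Group.group) sum_subgroup_mobius:
  assumes fin: "finite (carrier G)" and H: "subgroup H G"
  shows "(\<Sum>K\<in>{K. subgroup K G \<and> K \<subseteq> H}. of_nat (card K) * of_int (subgroup_mobius G K H)) =
    (of_nat (card (cyclic_generators H)) :: 'r :: comm_ring_1)"
  using mobius_inversion[OF finite_subgroups[OF fin], of "\<lambda>K. of_nat (card K)"
      "\<lambda>K. of_nat (card (cyclic_generators K)) :: 'r" H] H sum_cyclic_generators[OF fin]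
  by (simp add: subgroup_mobius_def flip: of_nat_sum)

lemma (in Group.group) card_conjugate:
  assumes g: "g \<in> carrier G" and H: "H \<subseteq> carrier G"
  shows "card (g <# H #> inv g) = card H"
proof -
  have "g <# H #> inv g = (\<lambda>h. g \<otimes> h \<otimes> inv g) ` H" by (auto simp: l_coset_def r_coset_def)
  moreover have "inj_on (\<lambda>h. g \<otimes> h \<otimes> inv g) H" using conjugation_is_inj[OF g] H by (auto intro!: inj_onI)
  ultimately show ?thesis by (simp add: card_image)
qed

text \<open>Conjugation is an automorphism of \<open>G\<close>, so it takes the subgroup generated
  by \<open>h\<close> to the one generated by the conjugate of \<open>h\<close>.\<close>

lemma (in Group.group) cyclic_generators_conjugate:
  assumes g: "g \<in> carrier G" and H: "subgroup H G"
  shows "cyclic_generators (g <# H #> inv g) = g <# cyclic_generators H #> inv g"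
proof -
  let ?c = "\<lambda>h. g \<otimes> h \<otimes> inv g"
  have img: "g <# A #> inv g = ?c ` A" for A by (auto simp: l_coset_def r_coset_def)
  have "?c \<in> hom G G"
    using g by (intro homI) (simp_all add: m_assoc inv_solve_left)
  then interpret c: group_hom G G ?c by unfold_locales
  have gen: "generate G {?c h} = ?c ` generate G {h}" if "h \<in> carrier G" for h
    using c.generate_img[of "{h}"] that by simp
  have inj: "inj_on ?c (carrier G)" using conjugation_is_inj[OF g] by (auto intro!: inj_onI)
  have surj: "\<exists>h\<in>carrier G. x = ?c h" if "x \<in> carrier G" for x
    using conjugation_is_surj[OF g that] that g by (intro bexI[of _ "inv g \<otimes> x \<otimes> g"]) auto
  \<comment> \<open>Injectivity on the whole carrier allows an equality of image subgroups to be
    pulled back.\<close>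
  have eq: "?c ` generate G {h} = ?c ` H \<longleftrightarrow> generate G {h} = H" if "h \<in> carrier G" for h
    using inj_on_image_eq_iff[OF inj] that generate_incl[of "{h}"] subgroup.subset[OF H] by auto
  show ?thesis
  proof (intro subset_antisym subsetI)
    fix x assume x: "x \<in> cyclic_generators (g <# H #> inv g)"
    then obtain h where h: "h \<in> carrier G" "x = ?c h" using surj by (auto simp: cyclic_generators_def)
    then have "h \<in> cyclic_generators H" using x gen eq by (simp add: cyclic_generators_def img)
    then show "x \<in> g <# cyclic_generators H #> inv g" using h by (auto simp: img)
  next
    fix x assume "x \<in> g <# cyclic_generators H #> inv g"
    then show "x \<in> cyclic_generators (g <# H #> inv g)"
      using g gen by (auto simp: cyclic_generators_def img)
  qed
qed

section \<open>Sums over conjugacy classes of subgroups\<close>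

text \<open>By orbit-stabilizer the factor counts the conjugates of \<open>H\<close>. Since
  \<open>w\<close> is constant on conjugacy classes and the classes of the representatives partition
  the subgroups, the weighted sum runs over every subgroup once.\<close>

lemma (in Group.group) sum_subgroup_classes:
  fixes w :: "'a set \<Rightarrow> 'r :: field_char_0"
  assumes fin: "finite (carrier G)" and S: "subgroup_class_reps G S"
    and w: "\<And>g H. g \<in> carrier G \<Longrightarrow> subgroup H G \<Longrightarrow> w (g <# H #> inv g) = w H"
  shows "(\<Sum>H\<in>S. of_nat (Coset.order G) / of_nat (card (normalizer G H)) * w H) = (\<Sum>H | subgroup H G. w H)"
proof -
  let ?\<phi> = "\<lambda>g. \<lambda>H\<in>{H. subgroup H G}. g <# H #> inv g"
  interpret A: group_action G "{H. subgroup H G}" ?\<phi>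
    by (rule action_by_conjugation_on_subgroups_set)
  have sub: "subgroup H G" if "H \<in> S" for H using S that by (simp add: subgroup_class_reps_def)
  have finS: "finite S" by (rule finite_subset[OF _ finite_subgroups[OF fin]]) (use sub in auto)
  have conj: "conjugate_subgroups G H K \<longleftrightarrow> K \<in> orbit G ?\<phi> H" if "subgroup H G" for H K
    using that by (auto simp: conjugate_subgroups_def orbit_def)
  have orb_sub: "K \<in> orbit G ?\<phi> H \<Longrightarrow> subgroup K G" if "subgroup H G" for H K
    using that subgroup_conjugation_is_surj2 by (auto simp: orbit_def)
  have weight: "of_nat (Coset.order G) / of_nat (card (normalizer G H)) * w H = (\<Sum>K\<in>orbit G ?\<phi> H. w K)"
    if H: "subgroup H G" for H
  proof -
    \<comment> \<open>\<open>normalizer\<close> is defined through conjugation on all subsets of the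
      carrier; at a subgroup this agrees with the action on subgroups.\<close>
    have st: "stabilizer G ?\<phi> H = normalizer G H"
      using H subgroup.subset[OF H] by (auto simp: normalizer_def stabilizer_def)
    have eq: "card (orbit G ?\<phi> H) * card (normalizer G H) = Coset.order G"
      using A.orbit_stabilizer_theorem[of H] H by (simp add: st)
    have "Coset.order G \<noteq> 0" using fin order_gt_0_iff_finite by auto
    then have "card (normalizer G H) \<noteq> 0" unfolding eq[symmetric] by simp
    then have "(of_nat (Coset.order G) / of_nat (card (normalizer G H)) :: 'r) = of_nat (card (orbit G ?\<phi> H))"
      by (simp flip: eq)
    moreover have "w K = w H" if "K \<in> orbit G ?\<phi> H" for K
      using that H w by (auto simp: orbit_def)
    ultimately show ?thesis by simp
  qed
  have cover: "(\<Union>H\<in>S. orbit G ?\<phi> H) = {H. subgroup H G}"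
  proof (intro subset_antisym subsetI)
    fix K assume "K \<in> {H. subgroup H G}"
    then have K: "subgroup K G" by simp
    then obtain H where H: "H \<in> S" "H \<in> orbit G ?\<phi> K"
      using S conj[OF K] by (auto simp: subgroup_class_reps_def)
    then show "K \<in> (\<Union>H\<in>S. orbit G ?\<phi> H)"
      using A.orbit_sym[of K H] K sub[OF H(1)] by blast
  qed (use sub orb_sub in blast)
  have disj: "orbit G ?\<phi> H \<inter> orbit G ?\<phi> K = {}" if "H \<in> S" "K \<in> S" "H \<noteq> K" for H K
  proof (rule ccontr)
    assume "orbit G ?\<phi> H \<inter> orbit G ?\<phi> K \<noteq> {}"
    \<comment> \<open>A common element \<open>L\<close> would be conjugate to two distinct
      representatives.\<close>
    then obtain L where L: "L \<in> orbit G ?\<phi> H" "L \<in> orbit G ?\<phi> K" by blast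
    have sL: "subgroup L G" using orb_sub[OF sub[OF that(1)] L(1)] .
    have "H \<in> orbit G ?\<phi> L" "K \<in> orbit G ?\<phi> L"
      using A.orbit_sym[of _ L] L sL sub that by auto
    then have "conjugate_subgroups G L H" "conjugate_subgroups G L K" using conj[OF sL] by auto
    moreover have "\<exists>!H. H \<in> S \<and> conjugate_subgroups G L H"
      using S sL by (simp add: subgroup_class_reps_def)
    ultimately show False using that by blast
  qed
  have "finite (orbit G ?\<phi> H)" if "H \<in> S" for H
    by (rule finite_subset[OF _ finite_subgroups[OF fin]]) (use orb_sub[OF sub[OF that]] in blast)
  then have "sum w (\<Union>H\<in>S. orbit G ?\<phi> H) = (\<Sum>H\<in>S. \<Sum>K\<in>orbit G ?\<phi> H. w K)"
    using disj by (intro sum.UNION_disjoint[OF finS]) blast+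
  also have "\<dots> = (\<Sum>H\<in>S. of_nat (Coset.order G) / of_nat (card (normalizer G H)) * w H)"
    by (rule sum.cong[OF refl]) (rule weight[OF sub, symmetric])
  finally show ?thesis unfolding cover by (rule sym)
qed

section \<open>Values on the idempotents and the final sum\<close>

lemma (in Group.group) burnside_idempotent_closed:
  assumes fin: "finite (carrier G)" 
  shows "burnside_idempotent G H \<in> carrier (rat_burnside_ring G)"
proof -
  interpret B: algebra rat_ring "rat_burnside_ring G" by (rule rat_burnside_algebra[OF is_group])
  show ?thesis
    unfolding burnside_idempotent_def
    by (intro B.smult_closed B.finsum_closed)
       (auto simp: rat_ring_simps intro!: B.smult_closed rat_burnside_class_closed[OF is_group] finite_gset_coset[OF fin])
qed

text \<open>Each coset space is a single orbit, so linearity leaves only the sum of the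
  coefficients. The value is zero for noncyclic \<open>H\<close>.\<close>

lemma (in Group.group) orbit_number_idempotent:
  assumes fin: "finite (carrier G)" and H: "subgroup H G"
  shows "orbit_number G (burnside_idempotent G H) =
    of_nat (card (cyclic_generators H)) / of_nat (card (normalizer G H))"
proof -
  interpret B: algebra rat_ring "rat_burnside_ring G" by (rule rat_burnside_algebra[OF is_group])
  note lin = orbit_number_linear
  have smult: "orbit_number G (q \<odot>\<^bsub>rat_burnside_ring G\<^esub> x) = q * orbit_number G x"
    if "x \<in> carrier (rat_burnside_ring G)" for q x
    using lin that by (simp add: linear_maps_def rat_ring_simps rat_self_simps)
  have fP: "finite {K. subgroup K G \<and> K \<subseteq> H}"
    by (rule finite_subset[OF _ finite_subgroups[OF fin]]) auto
  have cl: "rat_burnside_class G (coset_gset G K) \<in> carrier (rat_burnside_ring G)" if "subgroup K G" for K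
    by (rule rat_burnside_class_closed[OF is_group finite_gset_coset[OF fin that]])
  have scl: "q \<odot>\<^bsub>rat_burnside_ring G\<^esub> rat_burnside_class G (coset_gset G K) \<in> carrier (rat_burnside_ring G)"
    if "subgroup K G" for K q
    by (rule B.smult_closed[OF _ cl[OF that]]) (simp add: rat_ring_simps)
  have one: "orbit_number G (rat_burnside_class G (coset_gset G K)) = 1" if "subgroup K G" for K
    by (simp add: orbit_number_class[OF finite_gset_coset[OF fin that]] orbits_coset_gset[OF that])
  let ?x = "\<lambda>K. (of_nat (card K) * of_int (subgroup_mobius G K H)) \<odot>\<^bsub>rat_burnside_ring G\<^esub>
    rat_burnside_class G (coset_gset G K)"
  have "orbit_number G (finsum (rat_burnside_ring G) ?x {K. subgroup K G \<and> K \<subseteq> H}) =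
      (\<Sum>K\<in>{K. subgroup K G \<and> K \<subseteq> H}. orbit_number G (?x K))"
    by (rule linear_map_sum[OF B.module_axioms lin fP]) (simp add: scl)
  also have "\<dots> = of_nat (card (cyclic_generators H))"
    by (simp add: smult cl one sum_subgroup_mobius[OF fin H])
  finally have "orbit_number G (finsum (rat_burnside_ring G) ?x {K. subgroup K G \<and> K \<subseteq> H}) =
      of_nat (card (cyclic_generators H))" .
  moreover have "finsum (rat_burnside_ring G) ?x {K. subgroup K G \<and> K \<subseteq> H} \<in> carrier (rat_burnside_ring G)"
    by (rule B.finsum_closed) (simp add: Pi_iff scl)
  ultimately show ?thesis by (simp only: burnside_idempotent_def smult) simp
qed

theorem theorem3p2:
  fixes G :: "('g, 'm) monoid_scheme" and S :: "'g set set"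
  assumes "group G" and "finite (carrier G)" and "subgroup_class_reps G S"
  shows "orbit_number G (burnside_sigma G S) = inverse_order_sum G"
proof -
  interpret Group.group G by (rule assms(1))
  note fin = assms(2)
  interpret B: algebra rat_ring "rat_burnside_ring G" by (rule rat_burnside_algebra[OF is_group])
  note lin = orbit_number_linear
  let ?w = "\<lambda>H. of_nat (card (cyclic_generators H)) / of_nat (card H) :: rat"
  have sub: "subgroup H G" if "H \<in> S" for H using assms(3) that by (simp add: subgroup_class_reps_def)
  have finS: "finite S" by (rule finite_subset[OF _ finite_subgroups[OF fin]]) (use sub in auto)
  have scl: "q \<odot>\<^bsub>rat_burnside_ring G\<^esub> burnside_idempotent G H \<in> carrier (rat_burnside_ring G)" for q H
    by (rule B.smult_closed[OF _ burnside_idempotent_closed[OF fin]]) (simp add: rat_ring_simps)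
  have "orbit_number G (burnside_sigma G S) =
      (\<Sum>H\<in>S. of_nat (card (rcosets\<^bsub>G\<^esub> H)) * orbit_number G (burnside_idempotent G H))"
    unfolding burnside_sigma_def using lin burnside_idempotent_closed[OF fin]
    by (subst linear_map_sum[OF B.module_axioms lin finS scl])
       (simp add: linear_maps_def rat_ring_simps rat_self_simps)
  \<comment> \<open>Lagrange's theorem moves \<open>1 / |H|\<close> from the index into the weight
    \<open>?w\<close>, leaving the factor that counts conjugates.\<close>
  also have "\<dots> = (\<Sum>H\<in>S. of_nat (Coset.order G) / of_nat (card (normalizer G H)) * ?w H)"
  proof (intro sum.cong refl)
    fix H assume "H \<in> S"
    then have H: "subgroup H G" by (rule sub)
    have "card H \<noteq> 0"
      using subgroup.one_closed[OF H] finite_subset[OF subgroup.subset[OF H] fin] by auto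
    then show "of_nat (card (rcosets\<^bsub>G\<^esub> H)) * orbit_number G (burnside_idempotent G H) =
        of_nat (Coset.order G) / of_nat (card (normalizer G H)) * ?w H"
      by (simp add: orbit_number_idempotent[OF fin H] flip: lagrange[OF H])
  qed
  also have "\<dots> = (\<Sum>H | subgroup H G. ?w H)"
  proof (rule sum_subgroup_classes[OF fin assms(3)])
    fix g H assume "g \<in> carrier G" "subgroup H G"
    moreover have "cyclic_generators H \<subseteq> carrier G" by (auto simp: cyclic_generators_def)
    ultimately show "?w (g <#\<^bsub>G\<^esub> H #>\<^bsub>G\<^esub> inv\<^bsub>G\<^esub> g) = ?w H"
      by (simp add: cyclic_generators_conjugate card_conjugate subgroup.subset)
  qed
  \<comment> \<open>A generator of \<open>H\<close> has order \<open>card H\<close>, so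
    \<open>?w H\<close> is a sum of inverse orders over the generators.\<close>
  also have "\<dots> = (\<Sum>H | subgroup H G. \<Sum>g\<in>{g \<in> carrier G. generate G {g} = H}. 1 / of_nat (ord g))"
    by (intro sum.cong refl) (auto simp: cyclic_generators_def generate_pow_card)
  also have "\<dots> = inverse_order_sum G"
    unfolding inverse_order_sum_def
    \<comment> \<open>The inner sums run over the fibres of the map sending \<open>g\<close> to the
      subgroup it generates.\<close>
    by (rule sum.group[OF fin finite_subgroups[OF fin]]) (auto intro: generate_is_subgroup)
  finally show ?thesis .
qed

end
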